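(* Let $(K,|\cdot|)$ be a non-Archimedean nontrivially valued field, $k$ its residue field, $D$ its ring of integers, $\varepsilon\in(0,1]$ and $n\ge 2$. Let $R:=\mathbb{Z}$ (the prime ring of $K$) if $\operatorname{char}K\ne\operatorname{char}k$, and $R:=D$ otherwise. Then any ball $B$ (open or closed, of positive radius) in $K^n$ not containing $\mathbf{0}$ is $\mathrm{SL}(n,R,\varepsilon)$-paradoxical using $4$ pieces.
   Context: A non-Archimedean valuation on a field $K$ is a function $|\cdot|:K\to[0,\infty)$ with $|x|=0\iff x=0$, $|xy|=|x||y|$, $|x+y|\le\max\{|x|,|y|\}$; it is nontrivial if $\{|x|:x\in K,x\neq0\}\ne\{1\}$. $D=\{x\in K:|x|\le1\}$ is the ring of integers, $\mathfrak m=\{x:|x|<1\}$ its maximal ideal, $k=D/\mathfrak m$ the residue field. If $\operatorname{char}K\neq\operatorname{char}k$ then $\operatorname{char}K=0$, and $\mathbb{Z}$ is regarded as a subring of $D$. $K^n$ carries the norm $\|x\|=\max_i|x_i|$. Closed and open balls are $B[x,r]=\{y:\|y-x\|\le r\}$, $B(x,r)=\{y:\|y-x\|<r\}$, $r>0$. For a subring $R\subseteq D$ containing $1$ and $\varepsilon\in(0,1]$, $\mathrm{SL}(n,R,\varepsilon)$ is the group of matrices $[a_{ij}]\in\mathrm{SL}(n,R)$ with $|a_{ii}-1|<\varepsilon$ for all $i$ and $|a_{ij}|<\varepsilon$ for all $i\neq j$; it acts on $K^n$ by matrix multiplication on column vectors. For a group $G$ acting on a set $X$ and $A,B\subseteq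 X$, write $A\sim_{G,m}B$ if there are partitions $A=\bigsqcup_{i=1}^mA_i$, $B=\bigsqcup_{i=1}^mB_i$ into (possibly empty) subsets and $g_1,\dots,g_m\in G$ with $g_i(A_i)=B_i$. A nonempty set $E\subseteq X$ is $G$-paradoxical using $r$ pieces if $E=A\sqcup B$ with $A\sim_{G,m}E$ and $B\sim_{G,l}E$ for some $m,l\ge1$ with $m+l=r$. The axiom of choice is assumed. *)

theory Defs
  imports "HOL-Analysis.Determinants" "HOL-Algebra.QuotRing" "HOL-Algebra.Group_Action"
begin

section \<open>Non-Archimedean valued fields\<close>

locale nonarch_valuation =
  fixes v :: "'a::field \<Rightarrow> real"
  assumes val_nonneg: "0 \<le> v x"
    and val_eq_0_iff: "v x = 0 \<longleftrightarrow> x = 0"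
    and val_mult: "v (x * y) = v x * v y"
    and val_ultrametric: "v (x + y) \<le> max (v x) (v y)"

definition nontrivial_valuation :: "('a::field \<Rightarrow> real) \<Rightarrow> bool"
  where "nontrivial_valuation v \<longleftrightarrow> v ` (UNIV - {0}) \<noteq> {1}"

definition integers_of :: "('a::field \<Rightarrow> real) \<Rightarrow> 'a set"
  where "integers_of v = {x. v x \<le> 1}"

definition max_ideal_of :: "('a::field \<Rightarrow> real) \<Rightarrow> 'a set"
  where "max_ideal_of v = {x. v x < 1}"

definition integer_ring :: "('a::field \<Rightarrow> real) \<Rightarrow> 'a ring"
  where "integer_ring v = \<lparr>carrier = integers_of v, mult = (*), one = 1, zero = 0, add = (+)\<rparr>"

definition residue_field :: "('a::field \<Rightarrow> real) \<Rightarrow> 'a set ring"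
  where "residue_field v = integer_ring v Quot max_ideal_of v"

text \<open>The counterpart of \<^const>\<open>semiring_char\<close> for rings with an explicit carrier;
  it is \<open>0\<close> if no positive multiple of the unit vanishes.\<close>

definition ring_char :: "('r, 'b) ring_scheme \<Rightarrow> nat"
  where "ring_char S = Gcd {n::nat. add_pow S n \<one>\<^bsub>S\<^esub> = \<zero>\<^bsub>S\<^esub>}"

text \<open>\<^term>\<open>\<int>\<close> is the image of the integers in the field.\<close>

definition coefficient_ring :: "('a::field \<Rightarrow> real) \<Rightarrow> 'a set"
  where "coefficient_ring v =
    (if CHAR('a) \<noteq> ring_char (residue_field v) then \<int> else integers_of v)"

definition vec_norm :: "('a::field \<Rightarrow> real) \<Rightarrow> 'a ^ 'n \<Rightarrow> real"
  where "vec_norm v x = Max (range (\<lambda>i. v (x $ i)))"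

definition closed_ball :: "('a::field \<Rightarrow> real) \<Rightarrow> 'a ^ 'n \<Rightarrow> real \<Rightarrow> ('a ^ 'n) set"
  where "closed_ball v x r = {y. vec_norm v (y - x) \<le> r}"

definition open_ball :: "('a::field \<Rightarrow> real) \<Rightarrow> 'a ^ 'n \<Rightarrow> real \<Rightarrow> ('a ^ 'n) set"
  where "open_ball v x r = {y. vec_norm v (y - x) < r}"

definition SL :: "('a::field \<Rightarrow> real) \<Rightarrow> 'a set \<Rightarrow> real \<Rightarrow> ('a ^ 'n ^ 'n) monoid"
  where "SL v R \<epsilon> =
    \<lparr>carrier = {A. (\<forall>i j. A $ i $ j \<in> R) \<and> det A = 1 \<and>
                   (\<forall>i. v (A $ i $ i - 1) < \<epsilon>) \<and> (\<forall>i j. i \<noteq> j \<longrightarrow> v (A $ i $ j) < \<epsilon>)},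
     mult = (**), one = mat 1\<rparr>"


section \<open>Equidecomposability and paradoxical sets\<close>

text \<open>As in \<^locale>\<open>group_action\<close>, an action of a group \<open>G\<close> is a map \<open>\<phi>\<close> from \<open>G\<close> to
  functions on the underlying set.\<close>

definition equidecomposable ::
  "('g, 'b) monoid_scheme \<Rightarrow> ('g \<Rightarrow> 'x \<Rightarrow> 'x) \<Rightarrow> nat \<Rightarrow> 'x set \<Rightarrow> 'x set \<Rightarrow> bool"
  where "equidecomposable G \<phi> m A B \<longleftrightarrow>
    (\<exists>P Q g. disjoint_family_on P {1..m} \<and> (\<Union>i\<in>{1..m}. P i) = A \<and>
             disjoint_family_on Q {1..m} \<and> (\<Union>i\<in>{1..m}. Q i) = B \<and>
             (\<forall>i\<in>{1..m}. g i \<in> carrier G \<and> \<phi> (g i) ` P i = Q i))"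

definition paradoxical_using ::
  "('g, 'b) monoid_scheme \<Rightarrow> ('g \<Rightarrow> 'x \<Rightarrow> 'x) \<Rightarrow> nat \<Rightarrow> 'x set \<Rightarrow> bool"
  where "paradoxical_using G \<phi> r E \<longleftrightarrow> E \<noteq> {} \<and>
    (\<exists>A B m l. A \<inter> B = {} \<and> A \<union> B = E \<and> 1 \<le> m \<and> 1 \<le> l \<and> m + l = r \<and>
               equidecomposable G \<phi> m A E \<and> equidecomposable G \<phi> l B E)"


section \<open>Well-definedness\<close>

context nonarch_valuation
begin

lemma val_1: "v 1 = 1"
  using val_mult[of 1 1] val_eq_0_iff[of 1] by simp

lemma val_minus: "v (- x) = v x"
proof -
  have "v (-1) * v (-1) = 1"
    using val_mult[of "-1" "-1"] val_1 by simp
  hence "v (-1) = 1"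
    using val_nonneg[of "-1"] by (metis abs_of_nonneg abs_mult_self_eq one_power2 power2_eq_square power2_eq_imp_eq zero_le_one)
  thus ?thesis
    using val_mult[of "-1" x] by simp
qed

lemma val_sum_le:
  assumes "finite I" "0 \<le> c" "\<And>i. i \<in> I \<Longrightarrow> v (f i) \<le> c"
  shows "v (sum f I) \<le> c"
  using assms
proof (induction I rule: finite_induct)
  case empty
  then show ?case using val_eq_0_iff[of 0] by simp
next
  case (insert i I)
  then have "v (f i) \<le> c" "v (sum f I) \<le> c" by auto
  then show ?case using insert.hyps val_ultrametric[of "f i" "sum f I"] by simp
qed

lemma val_sum_less:
  assumes "finite I" "0 < c" "\<And>i. i \<in> I \<Longrightarrow> v (f i) < c"
  shows "v (sum f I) < c"
  using assms
proof (induction I rule: finite_induct)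
  case empty
  then show ?case using val_eq_0_iff[of 0] by simp
next
  case (insert i I)
  then have "v (f i) < c" "v (sum f I) < c" by auto
  then show ?case using insert.hyps val_ultrametric[of "f i" "sum f I"] by simp
qed

lemma cring_integer_ring: "cring (integer_ring v)"
proof (rule cringI)
  show "abelian_group (integer_ring v)"
  proof (rule abelian_groupI)
    fix x assume "x \<in> carrier (integer_ring v)"
    then show "\<exists>y\<in>carrier (integer_ring v). y \<oplus>\<^bsub>integer_ring v\<^esub> x = \<zero>\<^bsub>integer_ring v\<^esub>"
      by (intro bexI[of _ "- x"]) (auto simp: integer_ring_def integers_of_def val_minus)
  next
    fix x y assume "x \<in> carrier (integer_ring v)" "y \<in> carrier (integer_ring v)"
    then show "x \<oplus>\<^bsub>integer_ring v\<^esub> y \<in> carrier (integer_ring v)"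
      using val_ultrametric[of x y] by (auto simp: integer_ring_def integers_of_def)
  qed (use val_eq_0_iff[of 0] in \<open>auto simp: integer_ring_def integers_of_def\<close>)
  show "Group.comm_monoid (integer_ring v)"
    by (rule comm_monoidI)
       (auto simp: integer_ring_def integers_of_def val_mult val_1 val_nonneg intro: mult_le_one)
qed (auto simp: integer_ring_def distrib_right)

lemma field_residue_field: "field (residue_field v)"
proof -
  interpret D: cring "integer_ring v" by (rule cring_integer_ring)
  have "ideal (max_ideal_of v) (integer_ring v)"
  proof (rule idealI)
    show "ring (integer_ring v)" by (rule D.ring_axioms)
    show "subgroup (max_ideal_of v) (add_monoid (integer_ring v))"
    proof (rule group.subgroupI)
      show "Group.group (add_monoid (integer_ring v))" by (rule D.a_group)
      show "max_ideal_of v \<subseteq> carrier (add_monoid (integer_ring v))"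
        by (auto simp: max_ideal_of_def integer_ring_def integers_of_def)
      have "0 \<in> max_ideal_of v"
        using val_eq_0_iff[of 0] by (simp add: max_ideal_of_def)
      then show "max_ideal_of v \<noteq> {}" by auto
    next
      fix x assume x: "x \<in> max_ideal_of v"
      then have "x \<in> carrier (integer_ring v)"
        by (auto simp: max_ideal_of_def integer_ring_def integers_of_def)
      moreover have "- x \<in> carrier (integer_ring v)"
        using x by (auto simp: max_ideal_of_def integer_ring_def integers_of_def val_minus)
      moreover have "- x \<oplus>\<^bsub>integer_ring v\<^esub> x = \<zero>\<^bsub>integer_ring v\<^esub>"
        by (simp add: integer_ring_def)
      ultimately have "\<ominus>\<^bsub>integer_ring v\<^esub> x = - x"
        using D.minus_equality by blast
      then show "inv\<^bsub>add_monoid (integer_ring v)\<^esub> x \<in> max_ideal_of v"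
        using x by (simp add: a_inv_def max_ideal_of_def val_minus)
    next
      fix x y assume "x \<in> max_ideal_of v" "y \<in> max_ideal_of v"
      then show "x \<otimes>\<^bsub>add_monoid (integer_ring v)\<^esub> y \<in> max_ideal_of v"
        using val_ultrametric[of x y] by (auto simp: integer_ring_def max_ideal_of_def)
    qed
  next
    fix a x assume "a \<in> max_ideal_of v" "x \<in> carrier (integer_ring v)"
    then have a: "v a < 1" and x: "v x \<le> 1"
      by (auto simp: integer_ring_def integers_of_def max_ideal_of_def)
    have "v (x * a) < 1"
      using mult_right_mono[OF x val_nonneg[of a]] a by (simp add: val_mult)
    then show "x \<otimes>\<^bsub>integer_ring v\<^esub> a \<in> max_ideal_of v"
      "a \<otimes>\<^bsub>integer_ring v\<^esub> x \<in> max_ideal_of v"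
      by (auto simp: integer_ring_def max_ideal_of_def mult.commute)
  qed
  then have "maximalideal (max_ideal_of v) (integer_ring v)"
  proof (rule maximalidealI)
    have "1 \<in> carrier (integer_ring v)" "1 \<notin> max_ideal_of v"
      by (auto simp: integer_ring_def integers_of_def max_ideal_of_def val_1)
    then show "carrier (integer_ring v) \<noteq> max_ideal_of v" by blast
  next
    fix J assume J: "ideal J (integer_ring v)" "max_ideal_of v \<subseteq> J" "J \<subseteq> carrier (integer_ring v)"
    interpret J: ideal J "integer_ring v" by (rule J(1))
    show "J = max_ideal_of v \<or> J = carrier (integer_ring v)"
    proof (rule disjCI)
      assume "J \<noteq> carrier (integer_ring v)"
      have "x \<in> max_ideal_of v" if x: "x \<in> J" for x
      proof (rule ccontr)
        assume "x \<notin> max_ideal_of v"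
        then have vx: "v x = 1"
          using x J(3) by (auto simp: integer_ring_def integers_of_def max_ideal_of_def)
        then have "x \<noteq> 0" using val_eq_0_iff[of x] by auto
        then have "v (inverse x) = 1" using val_mult[of x "inverse x"] vx val_1 by simp
        then have "inverse x \<in> carrier (integer_ring v)"
          by (simp add: integer_ring_def integers_of_def)
        from J.I_l_closed[OF x this] have "\<one>\<^bsub>integer_ring v\<^esub> \<in> J"
          using \<open>x \<noteq> 0\<close> by (simp add: integer_ring_def)
        then have "J = carrier (integer_ring v)" by (rule J.one_imp_carrier)
        with \<open>J \<noteq> carrier (integer_ring v)\<close> show False by blast
      qed
      then show "J = max_ideal_of v" using J(2) by blast
    qed
  qed
  then show ?thesis
    unfolding residue_field_def
    by (rule maximalideal.quotient_is_field) (rule cring_integer_ring)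
qed

end

lemma SL_carrier_iff:
  "A \<in> carrier (SL v R \<epsilon>) \<longleftrightarrow>
     (\<forall>i j. A $ i $ j \<in> R) \<and> det A = 1 \<and> (\<forall>i j. v ((A - mat 1) $ i $ j) < \<epsilon>)"
  unfolding SL_def by (auto simp: mat_def)

lemma matrix_diff_ldistrib: "A ** (B - C) = A ** B - A ** C"
  for A B C :: "'a::field ^ 'n ^ 'n"
  by (simp add: matrix_matrix_mult_def vec_eq_iff right_diff_distrib sum_subtractf)

lemma group_SL:
  fixes v :: "'a::field \<Rightarrow> real" and R :: "'a set"
  assumes v: "nonarch_valuation v"
    and R: "R \<subseteq> integers_of v" "1 \<in> R" "\<And>x y. x \<in> R \<Longrightarrow> y \<in> R \<Longrightarrow> x - y \<in> R"
      "\<And>x y. x \<in> R \<Longrightarrow> y \<in> R \<Longrightarrow> x * y \<in> R"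
    and eps: "0 < \<epsilon>"
  shows "Group.group (SL v R \<epsilon> :: ('a ^ 'n ^ 'n) monoid)"
proof -
  interpret nonarch_valuation v by (rule v)
  have R0: "0 \<in> R" using R(3)[of 1 1] R(2) by simp
  have Rneg: "- x \<in> R" if "x \<in> R" for x using R(3)[OF R0 that] by simp
  have Radd: "x + y \<in> R" if "x \<in> R" "y \<in> R" for x y
    using R(3)[OF that(1) Rneg[OF that(2)]] by simp
  have Rsum: "sum f I \<in> R" if "\<And>i. i \<in> I \<Longrightarrow> f i \<in> R" for f :: "'i \<Rightarrow> 'a" and I
    using that by (induction I rule: infinite_finite_induct) (auto simp: R0 Radd)
  have Rprod: "prod f I \<in> R" if "\<And>i. i \<in> I \<Longrightarrow> f i \<in> R" for f :: "'i \<Rightarrow> 'a" and I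
    using that by (induction I rule: infinite_finite_induct) (auto simp: R(2,4))
  have Rdet: "det A \<in> R" if "\<And>i j. A $ i $ j \<in> R" for A :: "'a ^ 'n ^ 'n"
    unfolding det_def
    by (intro Rsum R(4) Rprod that) (auto simp: sign_def R(2) Rneg)
  have Rv: "v x \<le> 1" if "x \<in> R" for x using R(1) that by (auto simp: integers_of_def)
  let ?C = "carrier (SL v R \<epsilon> :: ('a ^ 'n ^ 'n) monoid)"
  have small: "v ((A ** M) $ i $ j) < \<epsilon>"
    if "\<And>i j. A $ i $ j \<in> R" "\<And>i j. v (M $ i $ j) < \<epsilon>" for A M :: "'a ^ 'n ^ 'n" and i j
  proof -
    have "v (A $ i $ k * M $ k $ j) < \<epsilon>" for k
      using mult_right_mono[OF Rv[OF that(1)[of i k]] val_nonneg[of "M $ k $ j"]] that(2)[of k j]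
      by (simp add: val_mult)
    then show ?thesis
      unfolding matrix_matrix_mult_def using eps by (auto intro!: val_sum_less)
  qed
  show ?thesis
  proof (rule groupI)
    fix A B assume A: "A \<in> ?C" and B: "B \<in> ?C"
    have "A ** B - mat 1 = A ** (B - mat 1) + (A - mat 1)"
      by (simp add: matrix_diff_ldistrib)
    moreover have "v ((A ** (B - mat 1) + (A - mat 1)) $ i $ j) < \<epsilon>" for i j
    proof -
      have "v ((A ** (B - mat 1)) $ i $ j) < \<epsilon>"
        by (rule small) (use A B in \<open>auto simp: SL_carrier_iff\<close>)
      moreover have "v ((A - mat 1) $ i $ j) < \<epsilon>" using A by (auto simp: SL_carrier_iff)
      ultimately show ?thesis
        using val_ultrametric[of "(A ** (B - mat 1)) $ i $ j" "(A - mat 1) $ i $ j"] by simp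
    qed
    moreover have "(A ** B) $ i $ j \<in> R" for i j
      using A B by (auto simp: SL_carrier_iff matrix_matrix_mult_def intro!: Rsum R(4))
    ultimately have "A ** B \<in> ?C"
      using A B unfolding SL_carrier_iff by (metis det_mul mult_1)
    then show "A \<otimes>\<^bsub>SL v R \<epsilon>\<^esub> B \<in> ?C" by (simp add: SL_def)
  next
    show "\<one>\<^bsub>SL v R \<epsilon>\<^esub> \<in> ?C"
      using eps R0 R(2) val_eq_0_iff[of 0] by (auto simp: SL_def mat_def det_I[unfolded mat_def])
  next
    fix A assume A: "A \<in> ?C"
    then have detA: "det A = 1" and RA: "\<And>i j. A $ i $ j \<in> R" by (auto simp: SL_carrier_iff)
    have "invertible A" using detA by (simp add: invertible_det_nz)
    then obtain B where AB: "A ** B = mat 1" and BA: "B ** A = mat 1"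
      by (auto simp: invertible_def)
    have RB: "B $ k $ l \<in> R" for k l
    proof -
      have "A *v column l B = axis l 1"
      proof -
        have "A *v column l B = column l (A ** B)"
          by (simp add: vec_eq_iff column_def matrix_matrix_mult_def matrix_vector_mult_def)
        also have "\<dots> = axis l 1"
          unfolding AB by (simp add: vec_eq_iff column_def mat_def axis_def)
        finally show ?thesis .
      qed
      then have "column l B = (\<chi> k. det (\<chi> i j. if j = k then axis l 1 $ i else A $ i $ j) / det A)"
        using cramer[of A] detA by auto
      then have "B $ k $ l = det (\<chi> i j. if j = k then axis l 1 $ i else A $ i $ j)"
        using detA by (simp add: column_def vec_eq_iff)
      also have "\<dots> \<in> R" by (rule Rdet) (auto simp: RA axis_def R0 R(2))
      finally show ?thesis .
    qed
    have "B - mat 1 = B ** (mat 1 - A)"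
      by (simp add: matrix_diff_ldistrib BA)
    moreover have "v ((B ** (mat 1 - A)) $ i $ j) < \<epsilon>" for i j
    proof (rule small[OF RB])
      fix i j
      have "v ((A - mat 1) $ i $ j) < \<epsilon>" using A by (auto simp: SL_carrier_iff)
      then show "v ((mat 1 - A) $ i $ j) < \<epsilon>"
        using val_minus[of "(A - mat 1) $ i $ j"] by simp
    qed
    moreover have "det B = 1"
      using det_mul[of A B] AB detA by (simp add: det_I)
    ultimately have "B \<in> ?C" by (simp add: SL_carrier_iff RB)
    then show "\<exists>B\<in>?C. B \<otimes>\<^bsub>SL v R \<epsilon>\<^esub> A = \<one>\<^bsub>SL v R \<epsilon>\<^esub>"
      using BA by (intro bexI[of _ B]) (simp_all add: SL_def)
  qed (auto simp: SL_def matrix_mul_assoc)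
qed

lemma group_action_SL:
  fixes v :: "'a::field \<Rightarrow> real" and \<epsilon> :: real
  defines "R \<equiv> coefficient_ring v"
  assumes v: "nonarch_valuation v" and eps: "0 < \<epsilon>"
  shows "group_action (SL v R \<epsilon> :: ('a ^ 'n ^ 'n) monoid) UNIV (*v)"
proof -
  interpret nonarch_valuation v by (rule v)
  have D1: "1 \<in> integers_of v" by (simp add: integers_of_def val_1)
  have Ddiff: "x - y \<in> integers_of v" if "x \<in> integers_of v" "y \<in> integers_of v" for x y
    using that val_ultrametric[of x "- y"] by (auto simp: integers_of_def val_minus)
  have Dmult: "x * y \<in> integers_of v" if "x \<in> integers_of v" "y \<in> integers_of v" for x y
    using that by (auto simp: integers_of_def val_mult val_nonneg intro: mult_le_one)
  have "of_nat n \<in> integers_of v" for n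
    using val_sum_le[of "{..<n}" 1 "\<lambda>_. 1"] by (simp add: integers_of_def val_1)
  then have ZD: "\<int> \<subseteq> integers_of v"
    by (auto elim!: Ints_cases) (metis Ddiff of_int_diff of_int_of_nat_eq int_diff_cases)
  have group: "Group.group (SL v R \<epsilon> :: ('a ^ 'n ^ 'n) monoid)"
    unfolding R_def coefficient_ring_def
    by (rule group_SL[OF v _ _ _ _ eps]) (auto split: if_splits simp: D1 Ddiff Dmult intro: subsetD[OF ZD])
  have "(*v) A \<in> Bij UNIV" if "A \<in> carrier (SL v R \<epsilon>)" for A :: "'a ^ 'n ^ 'n"
  proof -
    have "invertible A" using that by (simp add: SL_def invertible_det_nz)
    then obtain B where "A ** B = mat 1" "B ** A = mat 1" by (auto simp: invertible_def)
    then have "bij ((*v) A)"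
      by (intro o_bij[of "(*v) B"]) (auto simp: fun_eq_iff matrix_vector_mul_assoc)
    then show ?thesis by (simp add: Bij_def)
  qed
  then have "(*v) \<in> hom (SL v R \<epsilon> :: ('a ^ 'n ^ 'n) monoid) (BijGroup UNIV)"
    by (auto simp: hom_def BijGroup_def SL_def compose_def fun_eq_iff matrix_vector_mul_assoc)
  then show ?thesis
    using group by (simp add: group_action_def group_hom_def group_hom_axioms_def group_BijGroup)
qed

end

theory Submission
  imports Defs "HOL-Computational_Algebra.Polynomial"
begin

text \<open>An action of a free group on two generators in which stabilisers of points are commutative
  is paradoxical with four pieces: the stabiliser of a point fixes an end of the group, so there is
  an equivariant map from the space to the ends, along which the partition of the ends by their
  first letters is pulled back. Matrices that are sufficiently close to the identity leave a given
  ball invariant, so it suffices to find a free pair of such matrices that acts in this way on the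
  nonzero vectors.

  In \<open>SL\<^sub>2\<close> a free pair is obtained by ping-pong for an absolute value on the ring generated by
  its entries that is unrelated to \<open>v\<close>: the usual one on the integers in mixed characteristic, and
  otherwise the degree, the entries being polynomials in a transcendental element of small
  valuation. The group acts diagonally on a sum of copies of \<open>K\<^sup>2\<close> and, in odd dimension, of one
  copy of the three-dimensional space of matrices modulo scalars. Nonzero vectors of
  \<open>K\<^sup>2\<close> have unipotent stabilisers in \<open>SL\<^sub>2\<close>; an element that fixes a matrix modulo scalars and
  has nonzero trace commutes with it, and trace zero is excluded because the free group has no
  torsion.\<close>

section \<open>Words, reduced words and ends of a free group\<close>

type_synonym 'g letter = "'g \<times> bool"

definition linv :: "'g letter \<Rightarrow> 'g letter"
  where "linv l = (fst l, \<not> snd l)"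

definition winv :: "'g letter list \<Rightarrow> 'g letter list"
  where "winv w = rev (map linv w)"

lemma linv_linv [simp]: "linv (linv l) = l"
  by (simp add: linv_def)

lemma linv_neq [simp]: "linv l \<noteq> l" "l \<noteq> linv l"
  by (auto simp: linv_def prod_eq_iff)

lemma winv_simps [simp]: "winv [] = []" "winv (l # w) = winv w @ [linv l]"
  "winv (u @ w) = winv w @ winv u"
  by (auto simp: winv_def)

lemma winv_winv [simp]: "winv (winv w) = w"
  by (simp add: winv_def rev_map comp_def)

text \<open>A free group action given by its letters alone: words act through \<open>foldr\<close>,
  and the cancellation law suffices for a word and its reduced form to act alike
  (\<open>foldr_red\<close>). The group itself is never formed.\<close>

locale letter_action =
  fixes E :: "'x set" and \<alpha> :: "'g letter \<Rightarrow> 'x \<Rightarrow> 'x"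
  assumes closed: "x \<in> E \<Longrightarrow> \<alpha> l x \<in> E"
    and cancel: "x \<in> E \<Longrightarrow> \<alpha> (linv l) (\<alpha> l x) = x"
begin

lemma cancel': "x \<in> E \<Longrightarrow> \<alpha> l (\<alpha> (linv l) x) = x"
  using cancel[of x "linv l"] by simp

lemma word_closed: "x \<in> E \<Longrightarrow> foldr \<alpha> w x \<in> E"
  by (induction w) (auto simp: closed)

lemma winv_cancel: "x \<in> E \<Longrightarrow> foldr \<alpha> (winv w) (foldr \<alpha> w x) = x"
  by (induction w) (auto simp: cancel word_closed)

lemma winv_cancel': "x \<in> E \<Longrightarrow> foldr \<alpha> w (foldr \<alpha> (winv w) x) = x"
  using winv_cancel[of x "winv w"] by simp

end

definition reduced :: "'g letter list \<Rightarrow> bool"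
  where "reduced w \<longleftrightarrow> successively (\<lambda>k l. l \<noteq> linv k) w"

definition rcons :: "'g letter \<Rightarrow> 'g letter list \<Rightarrow> 'g letter list"
  where "rcons l w = (if w \<noteq> [] \<and> hd w = linv l then tl w else l # w)"

definition red :: "'g letter list \<Rightarrow> 'g letter list"
  where "red w = foldr rcons w []"

lemma reduced_Nil [simp]: "reduced []"
  by (simp add: reduced_def)

lemma reduced_Cons: "reduced (l # w) \<longleftrightarrow> reduced w \<and> (w \<noteq> [] \<longrightarrow> hd w \<noteq> linv l)"
  by (auto simp: reduced_def successively_Cons)

lemma reduced_append:
  "reduced (u @ w) \<longleftrightarrow> reduced u \<and> reduced w \<and> (u \<noteq> [] \<and> w \<noteq> [] \<longrightarrow> hd w \<noteq> linv (last u))"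
  by (auto simp: reduced_def successively_append_iff)

text \<open>Van der Waerden's trick: letters act on normal forms by left multiplication, so that
  \<open>red\<close>, the image of the empty word, is handled without a confluence argument for
  rewriting.\<close>

lemma letter_action_rcons: "letter_action {w. reduced w} rcons"
proof
  fix w :: "'g letter list" and l assume "w \<in> {w. reduced w}"
  then show "rcons l w \<in> {w. reduced w}" "rcons (linv l) (rcons l w) = w"
    by (cases w; auto simp: rcons_def reduced_Cons)+
qed

lemma reduced_red: "reduced (red w)"
  using letter_action.word_closed[OF letter_action_rcons, of "[]" w] by (simp add: red_def)

lemma foldr_rcons_reduced: "reduced (w @ u) \<Longrightarrow> foldr rcons w u = w @ u"
  by (induction w) (auto simp: rcons_def reduced_Cons)

lemma red_reduced: "reduced w \<Longrightarrow> red w = w"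
  using foldr_rcons_reduced[of w "[]"] by (simp add: red_def)

lemma (in letter_action) foldr_red:
  assumes "x \<in> E"
  shows "foldr \<alpha> (red w) x = foldr \<alpha> w x"
proof (induction w)
  case (Cons l w)
  have "foldr \<alpha> (rcons l u) x = \<alpha> l (foldr \<alpha> u x)" for u
    by (cases u) (auto simp: rcons_def assms cancel' word_closed)
  then show ?case using Cons by (simp add: red_def)
qed (simp add: red_def)

lemma red_append: "red (u @ w) = foldr rcons u (red w)"
  by (simp add: red_def)

lemma red_eqI:
  assumes "red (winv u @ w) = []"
  shows "red w = red u"
proof -
  interpret letter_action "{w. reduced w}" "rcons :: 'a letter \<Rightarrow> _"
    by (rule letter_action_rcons)
  have "foldr rcons u (foldr rcons (winv u) (red w)) = red w"
    by (simp add: winv_cancel' reduced_red)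
  moreover have "foldr rcons (winv u) (red w) = []"
    using assms by (simp add: red_append)
  ultimately show ?thesis by (simp add: red_def)
qed

text \<open>Letters disappear in pairs, the last ones of \<open>w\<close> against the first ones of
  \<open>u\<close>. A long reduced \<open>w\<close> therefore keeps its beginning, whatever
  \<open>u\<close> is.\<close>

lemma foldr_rcons_cancellation:
  assumes "reduced w"
  shows "\<exists>c. c \<le> length w \<and> c \<le> length u \<and> foldr rcons w u = take (length w - c) w @ drop c u"
  using assms
proof (induction w)
  case (Cons l w)
  then obtain c where c: "c \<le> length w" "c \<le> length u"
    "foldr rcons w u = take (length w - c) w @ drop c u"
    by (auto simp: reduced_Cons)
  show ?case
  proof (cases "c < length w")
    \<comment> \<open>Some of \<open>w\<close> survives, so its head is intact and \<open>l\<close>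
      cannot cancel against it.\<close>
    case True
    then have "foldr rcons w u \<noteq> []" "hd (foldr rcons w u) = hd w" "w \<noteq> []"
      using c by (auto simp: hd_append)
    then have "foldr rcons (l # w) u = l # foldr rcons w u"
      using Cons.prems by (auto simp: rcons_def reduced_Cons)
    then show ?thesis
      using c True by (intro exI[of _ c]) (auto simp: Suc_diff_le)
  next
    case False
    then have eq: "foldr rcons w u = drop (length w) u" and c': "c = length w" using c by auto
    show ?thesis
    proof (cases "drop (length w) u \<noteq> [] \<and> hd (drop (length w) u) = linv l")
      case True
      then have "foldr rcons (l # w) u = drop (Suc (length w)) u"
        using eq by (simp add: rcons_def tl_drop drop_Suc)
      then show ?thesis using True by (intro exI[of _ "Suc (length w)"]) auto
    next
      case False
      then have "foldr rcons (l # w) u = l # drop (length w) u" using eq by (auto simp: rcons_def)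
      then show ?thesis using c c' by (intro exI[of _ c]) auto
    qed
  qed
qed (auto simp: rcons_def)

subsection \<open>Cyclically reduced words\<close>

definition wpow :: "nat \<Rightarrow> 'g letter list \<Rightarrow> 'g letter list"
  where "wpow n w = concat (replicate n w)"

lemma wpow_simps [simp]: "wpow 0 w = []" "wpow (Suc n) w = w @ wpow n w"
  by (simp_all add: wpow_def)

lemma length_wpow [simp]: "length (wpow n w) = n * length w"
  by (induction n) auto

lemma hd_wpow: "n > 0 \<Longrightarrow> hd (wpow n w) = hd w"
  by (induction n) (auto simp: hd_append wpow_def)

lemma wpow_eq_Nil [simp]: "wpow n w = [] \<longleftrightarrow> n = 0 \<or> w = []"
  by (induction n) auto

lemma reduced_wpow:
  assumes "reduced (w @ w)"
  shows "reduced (wpow n w)"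
proof (induction n)
  case (Suc n)
  then show ?case using assms by (cases "n = 0") (auto simp: reduced_append hd_wpow)
qed simp

lemma nth_wpow: "i < n * length w \<Longrightarrow> wpow n w ! i = w ! (i mod length w)"
proof (induction n arbitrary: i)
  case (Suc n)
  show ?case
  proof (cases "i < length w")
    case False
    then have "i - length w < n * length w" using Suc.prems by auto
    from Suc.IH[OF this] show ?thesis using False by (simp add: nth_append le_mod_geq)
  qed (simp add: nth_append)
qed simp

text \<open>As long as the outer letters are inverse to each other, they are moved into
  \<open>p\<close>. The condition \<open>reduced (u @ u)\<close> says that the core \<open>u\<close>
  is cyclically reduced.\<close>

lemma reduced_conj_cyclically_reduced:
  assumes "reduced w" "w \<noteq> []"
  shows "\<exists>p u. w = p @ u @ winv p \<and> u \<noteq> [] \<and> reduced (u @ u)"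
  using assms
proof (induction "length w" arbitrary: w rule: less_induct)
  case less
  show ?case
  proof (cases "reduced (w @ w)")
    case True
    then show ?thesis using less.prems by (intro exI[of _ "[]"] exI[of _ w]) auto
  next
    case False
    then have hl: "hd w = linv (last w)" using less.prems by (auto simp: reduced_append)
    obtain l w' where w: "w = l # w'" using less.prems by (cases w) auto
    have "w' \<noteq> []" using hl w by auto
    then obtain u where w': "w' = u @ [linv l]"
      using hl w by (metis append_butlast_last_id last_ConsR linv_linv list.sel(1))
    have "u \<noteq> []" "reduced u" using less.prems(1) unfolding w w'
      by (auto simp: reduced_Cons reduced_append)
    with less.hyps[of u] obtain p v where "u = p @ v @ winv p" "v \<noteq> []" "reduced (v @ v)"
      unfolding w w' by auto
    then show ?thesis unfolding w w' by (intro exI[of _ "l # p"] exI[of _ v]) auto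
  qed
qed

text \<open>Free groups are torsion-free: there is no cancellation in the powers of a cyclically
  reduced core, and conjugation does not affect triviality.\<close>

lemma red_wpow_eq_NilD:
  assumes "red (wpow n w) = []" "n > 0"
  shows "red w = []"
proof (rule ccontr)
  interpret letter_action "{w. reduced w}" "rcons :: 'a letter \<Rightarrow> _"
    by (rule letter_action_rcons)
  assume "red w \<noteq> []"
  with reduced_conj_cyclically_reduced[OF reduced_red] obtain p u
    where pu: "red w = p @ u @ winv p" "u \<noteq> []" "reduced (u @ u)" by blast
  \<comment> \<open>The relation between the powers of \<open>w\<close> and those of its core, with
    \<open>p\<close> carried to the left, as an identity of actions on reduced words.\<close>
  have conj: "foldr rcons (wpow k w) (foldr rcons p z) = foldr rcons p (foldr rcons (wpow k u) z)"
    if "reduced z" for k z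
    using that
  proof (induction k)
    case (Suc k)
    let ?y = "foldr rcons (wpow k u) z"
    have y: "reduced ?y" using word_closed[of z] Suc.prems by simp
    have "foldr rcons (wpow (Suc k) w) (foldr rcons p z) = foldr rcons (red w) (foldr rcons p ?y)"
      using foldr_red[of "foldr rcons p ?y" w] word_closed[of ?y p] y Suc by simp
    also have "\<dots> = foldr rcons p (foldr rcons u ?y)"
      using winv_cancel[of ?y p] y by (simp add: pu)
    finally show ?case by simp
  qed simp
  let ?z = "red (winv p)"
  have p: "foldr rcons p ?z = []" using winv_cancel'[of "[]" p] by (simp add: red_def)
  then have "foldr rcons p (foldr rcons (wpow n u) ?z) = []"
    using conj[of ?z n] assms(1) reduced_red[of "winv p"] by (simp add: red_def)
  then have "foldr rcons (wpow n u) ?z = ?z"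
    using winv_cancel[of "foldr rcons (wpow n u) ?z" p] word_closed[of ?z] reduced_red[of "winv p"]
    by (simp add: red_def)
  then have "red (wpow n u @ winv p) = red (winv p)" by (simp add: red_append)
  then have "red (wpow n u @ winv p @ p) = red (winv p @ p)"
    using foldr_red[of "red p" "wpow n u @ winv p"] foldr_red[of "red p" "winv p"] reduced_red[of p]
    by (metis append.assoc mem_Collect_eq red_append)
  moreover have "red (winv p @ p) = []" using winv_cancel[of "[]" p] by (simp add: red_def)
  ultimately have "red (wpow n u) = []" by (simp add: red_append) (simp add: red_def)
  then show False using red_reduced[OF reduced_wpow[OF pu(3), of n]] pu(2) assms(2) by simp
qed

subsection \<open>Ends\<close>

text \<open>The boundary points of the free group, as infinite reduced words; \<open>econs\<close>
  extends \<open>rcons\<close> to them.\<close>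

definition reduced_end :: "(nat \<Rightarrow> 'g letter) \<Rightarrow> bool"
  where "reduced_end \<eta> \<longleftrightarrow> (\<forall>i. \<eta> (Suc i) \<noteq> linv (\<eta> i))"

definition econs :: "'g letter \<Rightarrow> (nat \<Rightarrow> 'g letter) \<Rightarrow> nat \<Rightarrow> 'g letter"
  where "econs l \<eta> = (if \<eta> 0 = linv l then \<lambda>i. \<eta> (Suc i) else case_nat l \<eta>)"

lemma letter_action_econs: "letter_action {\<eta>. reduced_end \<eta>} econs"
proof
  fix \<eta> :: "nat \<Rightarrow> 'g letter" and l assume \<eta>: "\<eta> \<in> {\<eta>. reduced_end \<eta>}"
  then show "econs l \<eta> \<in> {\<eta>. reduced_end \<eta>}"
    by (auto simp: econs_def reduced_end_def split: nat.split)
  show "econs (linv l) (econs l \<eta>) = \<eta>"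
  proof (cases "\<eta> 0 = linv l")
    case True
    then have "\<eta> (Suc 0) \<noteq> l" using \<eta> by (metis linv_linv mem_Collect_eq reduced_end_def)
    then show ?thesis using True by (auto simp: econs_def split: nat.split)
  qed (auto simp: econs_def)
qed

text \<open>If \<open>l\<close> cancels, then the new first letter followed \<open>linv l\<close> in
  a reduced end, so it is not \<open>l\<close>. The labelling of the space inherits this
  equivalence.\<close>

lemma econs_0_iff:
  assumes "reduced_end \<eta>"
  shows "econs l \<eta> 0 = l \<longleftrightarrow> \<eta> 0 \<noteq> linv l"
  using assms by (auto simp: econs_def reduced_end_def) (metis linv_linv)

definition agree :: "nat \<Rightarrow> 'g letter list \<Rightarrow> (nat \<Rightarrow> 'g letter) \<Rightarrow> bool"
  where "agree j w \<eta> \<longleftrightarrow> j \<le> length w \<and> (\<forall>i<j. w ! i = \<eta> i)"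

text \<open>Continuity of the action at the ends: each letter of \<open>h\<close> costs at most one
  place of agreement.\<close>

lemma agree_foldr:
  assumes "agree (j + length h) w \<eta>"
  shows "agree j (foldr rcons h w) (foldr econs h \<eta>)"
  using assms
proof (induction h arbitrary: j)
  case (Cons l h)
  let ?u = "foldr rcons h w" and ?\<zeta> = "foldr econs h \<eta>"
  from Cons.IH[of "Suc j"] Cons.prems have a: "agree (Suc j) ?u ?\<zeta>" by simp
  then obtain k u where u: "?u = k # u" by (cases ?u) (auto simp: agree_def)
  from a have "?u ! 0 = ?\<zeta> 0" by (auto simp: agree_def)
  then have k: "?\<zeta> 0 = k" using u by simp
  show ?case
  proof (cases "k = linv l")
    case True
    then have "foldr rcons (l # h) w = u" "foldr econs (l # h) \<eta> = (\<lambda>i. ?\<zeta> (Suc i))"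
      using u k by (simp_all add: rcons_def econs_def)
    then show ?thesis using a u by (auto simp: agree_def)
  next
    case False
    then have "foldr rcons (l # h) w = l # ?u" "foldr econs (l # h) \<eta> = case_nat l ?\<zeta>"
      using u k by (auto simp: rcons_def econs_def)
    then show ?thesis using a by (auto simp: agree_def nth_Cons split: nat.splits)
  qed
qed simp

text \<open>The end \<open>\<xi>\<close> is the limit of the powers of \<open>w\<close>. By
  continuity \<open>h @ wpow n w\<close> tends to the image of \<open>\<xi>\<close> under
  \<open>h\<close>, whereas \<open>wpow n w @ h\<close> keeps most of \<open>wpow n w\<close> and
  tends to \<open>\<xi>\<close>.\<close>

lemma periodic_end_fixed:
  assumes w: "w \<noteq> []" "reduced (w @ w)"
    and comm: "\<And>n. red (h @ wpow n w) = red (wpow n w @ h)"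
  defines "\<xi> \<equiv> \<lambda>i. w ! (i mod length w)"
  shows "reduced_end \<xi>" "foldr econs h \<xi> = \<xi>"
proof -
  let ?m = "length w"
  have m: "?m > 0" using w by simp
  have nth: "wpow n w ! i = \<xi> i" if "i < n * ?m" for i n
    using nth_wpow[OF that] by (simp add: \<xi>_def)
  have big: "n * ?m \<ge> n" for n using m by (cases ?m) auto
  show "reduced_end \<xi>"
    unfolding reduced_end_def
  proof
    fix i
    let ?u = "wpow (Suc (Suc i)) w"
    have l: "Suc i < length ?u" using big[of "Suc (Suc i)"] unfolding length_wpow by linarith
    have "reduced ?u" by (rule reduced_wpow[OF w(2)])
    then have "?u ! Suc i \<noteq> linv (?u ! i)"
      unfolding reduced_def successively_conv_nth using l by auto
    then show "\<xi> (Suc i) \<noteq> linv (\<xi> i)"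
      using l nth[of i "Suc (Suc i)"] nth[of "Suc i" "Suc (Suc i)"] unfolding length_wpow by auto
  qed
  show "foldr econs h \<xi> = \<xi>"
  proof
    fix i
    let ?k = "length h + length (red h)"
    \<comment> \<open>Place \<open>i\<close> must survive both losses: \<open>length h\<close>
      places of agreement on one side, up to \<open>length (red h)\<close> cancelled letters on the
      other.\<close>
    define N where "N = Suc i + ?k"
    let ?u = "wpow N w"
    have len: "length ?u \<ge> N" using big[of N] by simp
    have red: "red ?u = ?u" by (rule red_reduced[OF reduced_wpow[OF w(2)]])
    have "agree (length ?u) ?u \<xi>" using nth by (auto simp: agree_def)
    then have "agree (length ?u - length h) (foldr rcons h ?u) (foldr econs h \<xi>)"
      using agree_foldr[of "length ?u - length h" h ?u \<xi>] len by (simp add: N_def)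
    then have "foldr rcons h ?u ! i = foldr econs h \<xi> i"
      using len by (auto simp: agree_def N_def)
    moreover have "foldr rcons h ?u = foldr rcons ?u (red h)"
      using comm[of N] red by (simp add: red_append)
    moreover obtain c where "c \<le> length (red h)"
      "foldr rcons ?u (red h) = take (length ?u - c) ?u @ drop c (red h)"
      using foldr_rcons_cancellation[OF reduced_wpow[OF w(2)], of N "red h"] by blast
    then have "foldr rcons ?u (red h) ! i = ?u ! i"
      using len by (auto simp: nth_append N_def)
    moreover have "?u ! i = \<xi> i" using nth[of i N] len by (simp add: N_def)
    ultimately show "foldr econs h \<xi> i = \<xi> i" by simp
  qed
qed

text \<open>A locally commutative action admits an equivariant map to the ends: the stabiliser of a
  point fixes the end of the powers of a cyclically reduced element. The first letters of the
  ends give \<^term>\<open>f\<close>.\<close>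

lemma (in letter_action) locally_commutative_labelling:
  assumes comm: "\<And>x u w. \<lbrakk>x \<in> E; foldr \<alpha> u x = x; foldr \<alpha> w x = x\<rbrakk> \<Longrightarrow> red (u @ w) = red (w @ u)"
  shows "\<exists>f. \<forall>x\<in>E. \<forall>l. f (\<alpha> l x) = l \<longleftrightarrow> f x \<noteq> linv l"
proof -
  interpret ends: letter_action "{\<eta>. reduced_end \<eta>}" "econs :: 'b letter \<Rightarrow> _"
    by (rule letter_action_econs)
  define orb where "orb x = {y. \<exists>w. y = foldr \<alpha> w x}" for x
  have self: "x \<in> orb x" for x unfolding orb_def by (auto intro: exI[of _ "[]"])
  have orb_eq: "orb (foldr \<alpha> w x) = orb x" if "x \<in> E" for w x
  proof -
    have "foldr \<alpha> u x = foldr \<alpha> (u @ winv w) (foldr \<alpha> w x)" for u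
      using winv_cancel[OF that] by simp
    moreover have "foldr \<alpha> u (foldr \<alpha> w x) = foldr \<alpha> (u @ w) x" for u by simp
    ultimately show ?thesis unfolding orb_def by blast
  qed
  have fixed_end: "\<exists>y \<xi>. y \<in> orb x \<and> reduced_end \<xi> \<and> (\<forall>h. foldr \<alpha> h y = y \<longrightarrow> foldr econs h \<xi> = \<xi>)"
    if x: "x \<in> E" for x
  proof (cases "\<exists>w. foldr \<alpha> w x = x \<and> red w \<noteq> []")
    case False
    \<comment> \<open>The stabiliser is trivial here, so any reduced end will do; a constant
      sequence is one because no letter is its own inverse.\<close>
    let ?\<xi> = "\<lambda>_::nat. (undefined, True)"
    have "foldr econs h ?\<xi> = ?\<xi>" if "foldr \<alpha> h x = x" for h
      using False ends.foldr_red[of ?\<xi> h] that by (auto simp: reduced_end_def)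
    then show ?thesis using self
      by (intro exI[of _ x] exI[of _ ?\<xi>]) (auto simp: reduced_end_def)
  next
    case True
    then obtain w where w: "foldr \<alpha> w x = x" "red w \<noteq> []" by blast
    obtain p u where pu: "red w = p @ u @ winv p" "u \<noteq> []" "reduced (u @ u)"
      using reduced_conj_cyclically_reduced[OF reduced_red w(2)] by blast
    \<comment> \<open>Moving the point by the inverse of \<open>p\<close> replaces the stabilising
      element \<open>red w\<close> by its cyclically reduced core \<open>u\<close>.\<close>
    define y where "y = foldr \<alpha> (winv p) x"
    have y: "y \<in> E" "y \<in> orb x" using word_closed[OF x] by (auto simp: y_def orb_def)
    have "foldr \<alpha> p (foldr \<alpha> u y) = x" using foldr_red[OF x, of w] w pu by (simp add: y_def)
    then have uy: "foldr \<alpha> u y = y"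
      using winv_cancel[OF word_closed[OF y(1)], of p u] by (simp add: y_def)
    have uny: "foldr \<alpha> (wpow n u) y = y" for n by (induction n) (auto simp: uy)
    let ?\<xi> = "\<lambda>i. u ! (i mod length u)"
    have "reduced_end ?\<xi>" using periodic_end_fixed(1)[OF pu(2,3), of "[]"] by simp
    moreover have "foldr econs h ?\<xi> = ?\<xi>" if "foldr \<alpha> h y = y" for h
      by (rule periodic_end_fixed(2)[OF pu(2,3)]) (rule comm[OF y(1) that uny])
    ultimately show ?thesis using y(2) by blast
  qed
  \<comment> \<open>The choice depends on the orbit as a set, so all points of an orbit share one
    base point and one end.\<close>
  define Y where "Y Q = (SOME y\<xi>. fst y\<xi> \<in> Q \<and> reduced_end (snd y\<xi>) \<and>
    (\<forall>h. foldr \<alpha> h (fst y\<xi>) = fst y\<xi> \<longrightarrow> foldr econs h (snd y\<xi>) = snd y\<xi>))" for Q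
  have Y: "fst (Y (orb x)) \<in> orb x" "reduced_end (snd (Y (orb x)))"
    "\<And>h. foldr \<alpha> h (fst (Y (orb x))) = fst (Y (orb x)) \<Longrightarrow> foldr econs h (snd (Y (orb x))) = snd (Y (orb x))"
    if "x \<in> E" for x
    using someI_ex[of "\<lambda>y\<xi>. fst y\<xi> \<in> orb x \<and> reduced_end (snd y\<xi>) \<and>
      (\<forall>h. foldr \<alpha> h (fst y\<xi>) = fst y\<xi> \<longrightarrow> foldr econs h (snd y\<xi>) = snd y\<xi>)"] fixed_end[OF that]
    unfolding Y_def[symmetric] by auto
  define W where "W x = (SOME w. foldr \<alpha> w (fst (Y (orb x))) = x)" for x
  have W: "foldr \<alpha> (W x) (fst (Y (orb x))) = x" if x: "x \<in> E" for x
  proof -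
    obtain w where "fst (Y (orb x)) = foldr \<alpha> w x" using Y(1)[OF x] by (auto simp: orb_def)
    then have "foldr \<alpha> (winv w) (fst (Y (orb x))) = x" using winv_cancel[OF x] by simp
    then show ?thesis unfolding W_def by (rule someI)
  qed
  define \<beta> where "\<beta> x = foldr econs (W x) (snd (Y (orb x)))" for x
  have \<beta>_reduced: "reduced_end (\<beta> x)" if "x \<in> E" for x
    using ends.word_closed[of "snd (Y (orb x))"] Y(2)[OF that] by (simp add: \<beta>_def)
  have \<beta>_equiv: "\<beta> (\<alpha> l x) = econs l (\<beta> x)" if x: "x \<in> E" for l x
  proof -
    have o: "orb (\<alpha> l x) = orb x" using orb_eq[OF x, of "[l]"] by simp
    let ?y = "fst (Y (orb x))" and ?\<xi> = "snd (Y (orb x))"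
    have y: "?y \<in> E" using Y(1)[OF x] word_closed[OF x] by (auto simp: orb_def)
    have lx: "\<alpha> l x \<in> E" using closed[OF x] .
    \<comment> \<open>A loop at the base point that passes through \<open>x\<close> and its image
      under \<open>l\<close>. It fixes the chosen end, which makes the words chosen by
      \<open>W\<close> irrelevant.\<close>
    let ?h = "winv (W (\<alpha> l x)) @ [l] @ W x"
    have "foldr \<alpha> ?h ?y = ?y"
      using W[OF x] W[OF lx] winv_cancel[OF y, of "W (\<alpha> l x)"] by (simp add: o)
    then have "foldr econs ?h ?\<xi> = ?\<xi>" by (rule Y(3)[OF x])
    then have "foldr econs (W (\<alpha> l x)) (foldr econs ?h ?\<xi>) = \<beta> (\<alpha> l x)" by (simp add: \<beta>_def o)
    then show ?thesis
      using ends.winv_cancel'[of "foldr econs ([l] @ W x) ?\<xi>" "W (\<alpha> l x)"]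
        ends.word_closed[of ?\<xi> "[l] @ W x"] Y(2)[OF x] by (simp add: \<beta>_def)
  qed
  show ?thesis
    using econs_0_iff[OF \<beta>_reduced] \<beta>_equiv by (intro exI[of _ "\<lambda>x. \<beta> x 0"]) auto
qed

text \<open>With the labelling, every piece that is moved is mapped onto the complement of the one that
  stays in place.\<close>

lemma paradoxical_using_4:
  fixes g :: "bool letter \<Rightarrow> 'g" and G :: "('g, 'b) monoid_scheme" (structure)
  assumes act: "letter_action E (\<lambda>l. \<phi> (g l))"
    and g: "\<And>l. g l \<in> carrier G" and one: "\<one> \<in> carrier G" "\<And>x. x \<in> E \<Longrightarrow> \<phi> \<one> x = x"
    and comm: "\<And>x u w. \<lbrakk>x \<in> E; foldr (\<lambda>l. \<phi> (g l)) u x = x; foldr (\<lambda>l. \<phi> (g l)) w x = x\<rbrakk>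
      \<Longrightarrow> red (u @ w) = red (w @ u)"
    and "E \<noteq> {}"
  shows "paradoxical_using G \<phi> 4 E"
proof -
  interpret letter_action E "\<lambda>l. \<phi> (g l)" by (rule act)
  obtain f where f: "\<And>x l. x \<in> E \<Longrightarrow> f (\<phi> (g l) x) = l \<longleftrightarrow> f x \<noteq> linv l"
    using locally_commutative_labelling comm by metis
  define D where "D l = {x \<in> E. f x = l}" for l
  have moved: "\<phi> (g l) ` D (linv l) = E - D l" for l
  proof (intro subset_antisym subsetI)
    fix y assume "y \<in> \<phi> (g l) ` D (linv l)"
    then obtain x where "x \<in> E" "f x = linv l" "y = \<phi> (g l) x" by (auto simp: D_def)
    then show "y \<in> E - D l" using f[of x l] closed[of x l] by (simp add: D_def)
  next
    fix y assume "y \<in> E - D l"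
    then have y: "y \<in> E" "f y \<noteq> l" by (auto simp: D_def)
    then have "\<phi> (g (linv l)) y \<in> D (linv l)" using f[of y "linv l"] closed by (auto simp: D_def)
    then show "y \<in> \<phi> (g l) ` D (linv l)" using cancel'[OF y(1), of l] by force
  qed
  have fixed: "\<phi> \<one> ` D l = D l" for l using one(2) by (force simp: D_def)
  have eqd: "equidecomposable G \<phi> 2 (D l \<union> D (linv l)) E" for l
  proof -
    have two: "{1..2} = {1, 2::nat}" by auto
    show ?thesis
      unfolding equidecomposable_def two disjoint_family_on_def
      using fixed moved one(1) g
      by (intro exI[of _ "\<lambda>i::nat. if i = 1 then D l else D (linv l)"]
            exI[of _ "\<lambda>i::nat. if i = 1 then D l else E - D l"]
            exI[of _ "\<lambda>i::nat. if i = 1 then \<one> else g l"]) (auto simp: D_def)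
  qed
  \<comment> \<open>The two labels of a single generator already yield a copy of \<open>E\<close>,
    so each generator contributes one half of the paradox.\<close>
  let ?A = "\<lambda>b. D (b, True) \<union> D (b, False)"
  have "equidecomposable G \<phi> 2 (?A b) E" for b
    using eqd[of "(b, True)"] by (simp add: linv_def)
  moreover have "?A True \<inter> ?A False = {}" "?A True \<union> ?A False = E"
    by (auto simp: D_def) (metis (full_types) surj_pair)
  ultimately show ?thesis
    unfolding paradoxical_using_def using \<open>E \<noteq> {}\<close>
    by (intro conjI exI[of _ "?A True"] exI[of _ "?A False"] exI[of _ "2::nat"]) auto
qed

section \<open>A free pair of two by two matrices\<close>

text \<open>Quadruples over any commutative ring: the same words are evaluated over the integers,
  over polynomials and over the field.\<close>

type_synonym 'r mat2 = "'r \<times> 'r \<times> 'r \<times> 'r"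

fun mmul :: "'r::comm_ring_1 mat2 \<Rightarrow> 'r mat2 \<Rightarrow> 'r mat2"
  where "mmul (p, q, r, s) (p', q', r', s') =
    (p * p' + q * r', p * q' + q * s', r * p' + s * r', r * q' + s * s')"

definition mone :: "'r::comm_ring_1 mat2"
  where "mone = (1, 0, 0, 1)"

fun mdet :: "'r::comm_ring_1 mat2 \<Rightarrow> 'r"
  where "mdet (p, q, r, s) = p * s - q * r"

fun madj :: "'r::comm_ring_1 mat2 \<Rightarrow> 'r mat2"
  where "madj (p, q, r, s) = (s, - q, - r, p)"

fun mapp :: "'r::comm_ring_1 mat2 \<Rightarrow> 'r \<times> 'r \<Rightarrow> 'r \<times> 'r"
  where "mapp (p, q, r, s) (x, y) = (p * x + q * y, r * x + s * y)"

lemma mmul_assoc: "mmul (mmul m n) k = mmul m (mmul n k)"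
  by (cases m; cases n; cases k) (simp add: algebra_simps)

lemma mmul_mone [simp]: "mmul m mone = m" "mmul mone m = m"
  by (cases m; simp add: mone_def)+

lemma mdet_mmul: "mdet (mmul m n) = mdet m * mdet n"
  by (cases m; cases n) (simp add: algebra_simps)

lemma mdet_mone [simp]: "mdet mone = 1"
  by (simp add: mone_def)

lemma madj_madj [simp]: "madj (madj m) = m"
  by (cases m) simp

lemma mdet_madj [simp]: "mdet (madj m) = mdet m"
  by (cases m) (simp add: algebra_simps)

lemma madj_mmul: "madj (mmul m n) = mmul (madj n) (madj m)"
  by (cases m; cases n) (simp add: algebra_simps)

lemma madj_mone [simp]: "madj mone = mone"
  by (simp add: mone_def)

lemma mmul_madj: "mdet m = 1 \<Longrightarrow> mmul m (madj m) = mone" "mdet m = 1 \<Longrightarrow> mmul (madj m) m = mone"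
  by (cases m; simp add: mone_def algebra_simps)+

lemma mapp_mmul: "mapp (mmul m n) z = mapp m (mapp n z)"
  by (cases m; cases n; cases z) (simp add: algebra_simps)

lemma mapp_mone [simp]: "mapp mone z = z"
  by (cases z) (simp add: mone_def)

text \<open>The generators are composed of elementary matrices because these are commutators over
  the field, see \<open>det_rep_gen\<close>.\<close>

definition upper :: "'r::comm_ring_1 \<Rightarrow> 'r mat2"
  where "upper s = (1, s, 0, 1)"

definition lower :: "'r::comm_ring_1 \<Rightarrow> 'r mat2"
  where "lower s = (1, 0, s, 1)"

definition frame :: "'r::comm_ring_1 \<Rightarrow> 'r mat2"
  where "frame t = (1 + t, t, 1, 1)"

text \<open>The eigenlines of the first generator are close to the coordinate axes, and the ones of the
  second to the images of the axes under \<^term>\<open>frame t\<close>.\<close>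

definition agen :: "'r::comm_ring_1 \<Rightarrow> 'r mat2"
  where "agen s = mmul (upper s) (lower s)"

definition bgen :: "'r::comm_ring_1 \<Rightarrow> 'r \<Rightarrow> 'r mat2"
  where "bgen s t = mmul (mmul (frame t) (agen s)) (madj (frame t))"

definition gen :: "'r::comm_ring_1 \<Rightarrow> 'r \<Rightarrow> bool letter \<Rightarrow> 'r mat2"
  where "gen s t l = (let m = if fst l then agen s else bgen s t in if snd l then m else madj m)"

definition wmat :: "'r::comm_ring_1 \<Rightarrow> 'r \<Rightarrow> bool letter list \<Rightarrow> 'r mat2"
  where "wmat s t w = foldr (\<lambda>l. mmul (gen s t l)) w mone"

lemma agen_eq: "agen s = (1 + s * s, s, s, 1)"
  by (simp add: agen_def upper_def lower_def)

lemma mdet_frame [simp]: "mdet (frame t) = 1"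
  by (simp add: frame_def algebra_simps)

lemma mdet_agen [simp]: "mdet (agen s) = 1"
  by (simp add: agen_eq algebra_simps)

lemma mdet_gen [simp]: "mdet (gen s t l) = 1"
  by (simp add: gen_def Let_def bgen_def mdet_mmul)

lemma gen_linv: "gen s t (linv l) = madj (gen s t l)"
  by (simp add: gen_def linv_def Let_def)

lemma wmat_simps [simp]: "wmat s t [] = mone" "wmat s t (l # w) = mmul (gen s t l) (wmat s t w)"
  by (simp_all add: wmat_def)

lemma mdet_wmat [simp]: "mdet (wmat s t w) = 1"
  by (induction w) (auto simp: mdet_mmul)

lemma wmat_append: "wmat s t (u @ w) = mmul (wmat s t u) (wmat s t w)"
  by (induction u) (auto simp: mmul_assoc)

lemma wmat_winv: "wmat s t (winv w) = madj (wmat s t w)"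
  by (induction w) (auto simp: wmat_append madj_mmul gen_linv)

lemma wmat_red: "wmat s t (red w) = wmat s t w"
proof -
  interpret letter_action UNIV "\<lambda>l. mmul (gen s t l)"
    by standard (auto simp: gen_linv mmul_assoc[symmetric] mmul_madj)
  show ?thesis unfolding wmat_def by (rule foldr_red) simp
qed

subsection \<open>Ping-pong\<close>

text \<open>An absolute value on a ring that may have few units. The bound on \<open>s\<close>
  equals \<open>C + 2\<close>, the expansion that \<open>expanding\<close> asks for.\<close>

locale ping_pong =
  fixes N :: "'r::comm_ring_1 \<Rightarrow> real" and s t :: 'r
  assumes N_nonneg: "N x \<ge> 0" and N_eq_0_iff: "N x = 0 \<longleftrightarrow> x = 0"
    and N_mult: "N (x * y) = N x * N y" and N_minus: "N (- x) = N x"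
    and N_add: "N (x + y) \<le> N x + N y"
    and N_1: "N 1 = 1" and N_t: "N t \<ge> 2" and N_s: "N s \<ge> 4 + 2 * N t"
begin

lemma N_add_ge: "N (x + y) \<ge> N x - N y"
  using N_add[of "x + y" "- y"] by (simp add: N_minus)

lemma N_0 [simp]: "N 0 = 0"
  by (simp add: N_eq_0_iff)

definition C where "C = 2 + 2 * N t"

text \<open>Cones around the coordinate axes for the first generator and around their images under
  \<open>frame t\<close> for the second; the sign selects the axis that attracts.\<close>

definition attractor :: "bool letter \<Rightarrow> 'r \<times> 'r \<Rightarrow> bool"
  where "attractor l z \<longleftrightarrow> (let (x, y) = if fst l then z else mapp (madj (frame t)) z
    in if snd l then C * N y < N x else C * N x < N y)"

lemma attractor_simps [simp]:
  "attractor (True, True) (x, y) \<longleftrightarrow> C * N y < N x"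
  "attractor (True, False) (x, y) \<longleftrightarrow> C * N x < N y"
  "attractor (False, e) z \<longleftrightarrow> attractor (True, e) (mapp (madj (frame t)) z)"
  by (simp_all add: attractor_def)

text \<open>Two shears in turn: outside the repelling cone the first makes the second coordinate at
  least \<open>2 * N x\<close>, after which the second shear makes the first coordinate dominate by
  the factor \<open>C\<close>.\<close>

lemma expanding:
  assumes xy: "N y \<le> C * N x" "x \<noteq> 0 \<or> y \<noteq> 0" and \<sigma>: "N \<sigma> \<ge> C + 2"
  shows "C * N (\<sigma> * x + y) < N (x + \<sigma> * (\<sigma> * x + y))"
proof -
  let ?Y = "\<sigma> * x + y"
  have "x \<noteq> 0" using xy N_nonneg[of y] N_eq_0_iff[of y] by (cases "x = 0") auto
  then have x: "N x > 0" using N_nonneg[of x] N_eq_0_iff[of x] by linarith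
  have "N ?Y \<ge> N \<sigma> * N x - N y" using N_add_ge[of "\<sigma> * x" y] by (simp add: N_mult)
  moreover have "N \<sigma> * N x \<ge> (C + 2) * N x" using \<sigma> x by (intro mult_right_mono) auto
  ultimately have Y: "N ?Y \<ge> 2 * N x" using xy by (simp add: algebra_simps)
  have "N (x + \<sigma> * ?Y) \<ge> N \<sigma> * N ?Y - N x"
    using N_add_ge[of "\<sigma> * ?Y" x] by (simp add: N_mult add.commute)
  moreover have "N \<sigma> * N ?Y \<ge> (C + 2) * N ?Y" using \<sigma> N_nonneg by (intro mult_right_mono) auto
  ultimately show ?thesis using Y x by (simp add: algebra_simps)
qed

lemma attractor_gen_True:
  assumes "\<not> attractor (True, \<not> e) z" "z \<noteq> (0, 0)"
  shows "attractor (True, e) (mapp (gen s t (True, e)) z)"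
proof -
  obtain x y where z: "z = (x, y)" by (cases z)
  show ?thesis
  proof (cases e)
    case True
    have "C * N (s * x + y) < N (x + s * (s * x + y))"
      using assms True N_s by (intro expanding) (auto simp: z C_def)
    then show ?thesis using True by (simp add: z gen_def agen_eq algebra_simps)
  next
    case False
    \<comment> \<open>The inverse is the same product of shears with the coordinates exchanged and
      the sign of \<open>s\<close> changed.\<close>
    have "C * N (- s * y + x) < N (y + - s * (- s * y + x))"
      using assms False N_s by (intro expanding) (auto simp: z C_def N_minus)
    then show ?thesis using False by (simp add: z gen_def agen_eq algebra_simps)
  qed
qed

lemma attractor_gen:
  assumes "\<not> attractor (linv l) z" "z \<noteq> (0, 0)"
  shows "attractor l (mapp (gen s t l) z)"
proof -
  obtain b e where l: "l = (b, e)" by (cases l)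
  show ?thesis
  proof (cases b)
    case True
    then show ?thesis using assms attractor_gen_True by (simp add: l linv_def)
  next
    case False
    \<comment> \<open>In the coordinates of the frame the second generator acts as the first one
      does.\<close>
    define u where "u = mapp (madj (frame t)) z"
    have zu: "z = mapp (frame t) u" by (simp add: u_def mapp_mmul[symmetric] mmul_madj)
    then have "u \<noteq> (0, 0)" using assms(2) by (auto simp: frame_def)
    moreover have "\<not> attractor (True, \<not> e) u" using assms(1) False by (simp add: l linv_def u_def)
    ultimately have "attractor (True, e) (mapp (gen s t (True, e)) u)" by (rule attractor_gen_True[rotated])
    moreover have "gen s t (False, e) = mmul (frame t) (mmul (gen s t (True, e)) (madj (frame t)))"
      by (simp add: gen_def bgen_def madj_mmul mmul_assoc Let_def)
    then have "mmul (madj (frame t)) (gen s t (False, e)) = mmul (gen s t (True, e)) (madj (frame t))"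
      by (simp add: mmul_assoc[symmetric] mmul_madj)
    then have "mapp (madj (frame t)) (mapp (gen s t (False, e)) z) = mapp (gen s t (True, e)) u"
      by (metis mapp_mmul u_def)
    ultimately show ?thesis using False by (simp add: l)
  qed
qed

text \<open>A vector in a cone around a coordinate axis has frame coordinates \<open>u\<close>,
  \<open>w\<close> within a factor \<open>C\<close> of each other, so it is in no cone of the frame.
  Opposite cones of one generator are disjoint because \<open>C\<close> exceeds one.\<close>

lemma attractor_disjoint:
  assumes "attractor l z" "attractor k z"
  shows "l = k"
proof -
  obtain x y where z: "z = (x, y)" by (cases z)
  have C: "C \<ge> 6" using N_t by (simp add: C_def)
  have two: False if "C * N a < N b" "C * N b < N a" for a b
    using that mult_right_mono[OF C N_nonneg[of a]] mult_right_mono[OF C N_nonneg[of b]]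
      N_nonneg[of a] N_nonneg[of b] by linarith
  define u w where "u = x - t * y" and "w = - x + (1 + t) * y"
  have frame: "mapp (madj (frame t)) z = (u, w)"
    by (simp add: z frame_def u_def w_def algebra_simps)
  have ty: "N (t * y) = N t * N y" by (rule N_mult)
  have t1: "N ((1 + t) * y) \<le> N y + N t * N y" "N ((1 + t) * y) \<ge> N t * N y - N y"
    using N_add[of y "t * y"] N_add_ge[of "t * y" y] by (simp_all add: N_mult algebra_simps)
  have u: "N u \<le> N x + N (t * y)" "N u \<ge> N x - N (t * y)" "N u \<ge> N (t * y) - N x"
    using N_add[of x "- (t * y)"] N_add_ge[of x "- (t * y)"] N_add_ge[of "- (t * y)" x]
    by (simp_all add: u_def N_minus)
  have w: "N w \<le> N x + N ((1 + t) * y)" "N w \<ge> N x - N ((1 + t) * y)"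
    "N w \<ge> N ((1 + t) * y) - N x"
    using N_add[of "- x" "(1 + t) * y"] N_add_ge[of "- x" "(1 + t) * y"] N_add_ge[of "(1 + t) * y" "- x"]
    by (simp_all add: w_def N_minus)
  have Ty: "N t * N y \<ge> 2 * N y" using N_t N_nonneg by (intro mult_right_mono) auto
  have axes: "N u \<le> C * N w" "N w \<le> C * N u" if "C * N y < N x \<or> C * N x < N y"
  proof -
    have *: "N u \<le> C * N w \<and> N w \<le> C * N u"
      using that
    proof
      assume a: "C * N y < N x"
      then have "2 * N y + 2 * (N t * N y) < N x" by (simp add: C_def algebra_simps)
      moreover have "6 * N u \<le> C * N u" "6 * N w \<le> C * N w" by (intro mult_right_mono C N_nonneg)+
      ultimately show ?thesis using u w t1 ty Ty N_nonneg[of y] N_nonneg[of u] N_nonneg[of w] by linarith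
    next
      assume a: "C * N x < N y"
      moreover have "6 * N x \<le> C * N x" by (intro mult_right_mono C N_nonneg)
      ultimately have x: "6 * N x < N y" by linarith
      have "N u \<ge> 5 / 6 * N y" "N w \<ge> 5 / 6 * N y" using u w t1 ty Ty x by linarith+
      then have "C * (5 / 6 * N y) \<le> C * N u" "C * (5 / 6 * N y) \<le> C * N w"
        using C by (intro mult_left_mono; simp)+
      moreover have "C * (5 / 6 * N y) = 5 / 3 * N y + 5 / 3 * (N t * N y)"
        by (simp add: C_def algebra_simps)
      ultimately show ?thesis using u w t1 ty Ty x N_nonneg[of y] N_nonneg[of x] by linarith
    qed
    then show "N u \<le> C * N w" "N w \<le> C * N u" by auto
  qed
  show ?thesis
    using assms two axes frame
    by (cases l; cases k; cases "fst l"; cases "snd l"; cases "fst k"; cases "snd k")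
      (force simp: z)+
qed

text \<open>The vector \<open>(1, 1)\<close>, with frame coordinates \<open>(1 - t, t)\<close>, is
  in none of the cones, but a nonempty reduced word moves it into the cone of its first
  letter.\<close>

lemma wmat_neq_mone:
  assumes "reduced w" "w \<noteq> []"
  shows "wmat s t w \<noteq> mone"
proof
  assume one: "wmat s t w = mone"
  let ?z = "(1, 1)"
  have gap: "\<not> attractor l ?z" for l
  proof -
    have "N (1 - t) \<le> 1 + N t" "N (1 - t) \<ge> N t - 1"
      using N_add[of 1 "- t"] N_add_ge[of "- t" 1] by (simp_all add: N_minus N_1)
    moreover from this have "C * N (1 - t) \<ge> C * 1" "C * N t \<ge> C * 1"
      using N_t by (intro mult_left_mono; simp add: C_def)+
    moreover have "C = 2 + 2 * N t" by (rule C_def)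
    ultimately have "\<not> C * N t < N (1 - t)" "\<not> C * N (1 - t) < N t" using N_t by linarith+
    then show ?thesis using N_t
      by (cases l; cases "fst l"; cases "snd l") (auto simp: N_1 C_def frame_def)
  qed
  have "attractor (hd w) (mapp (wmat s t w) ?z)"
    using assms
  proof (induction w)
    case (Cons l w)
    have nz: "mapp (wmat s t w) ?z \<noteq> (0, 0)"
    proof
      assume "mapp (wmat s t w) ?z = (0, 0)"
      then have "mapp (madj (wmat s t w)) (mapp (wmat s t w) ?z) = (0, 0)"
        by (cases "wmat s t w") simp
      then show False using N_1 by (auto simp: mapp_mmul[symmetric] mmul_madj)
    qed
    have "\<not> attractor (linv l) (mapp (wmat s t w) ?z)"
    proof (cases "w = []")
      case False
      then show ?thesis using Cons.IH Cons.prems(1) attractor_disjoint by (metis reduced_Cons)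
    qed (simp add: gap)
    from attractor_gen[OF this nz] show ?case by (simp add: mapp_mmul)
  qed simp
  then show False using gap by (simp add: one)
qed

end

section \<open>From matrix identities back to words\<close>

lemma red_eq_if_wmat_eq:
  assumes free: "\<And>w. reduced w \<Longrightarrow> w \<noteq> [] \<Longrightarrow> wmat s t w \<noteq> mone"
    and eq: "wmat s t u = wmat s t w"
  shows "red u = red w"
proof (rule red_eqI)
  have "wmat s t (winv w @ u) = mone" by (simp add: wmat_append wmat_winv eq mmul_madj)
  then have "wmat s t (red (winv w @ u)) = mone" by (simp add: wmat_red)
  then show "red (winv w @ u) = []" using free reduced_red by blast
qed

fun mat2_map :: "('r \<Rightarrow> 's) \<Rightarrow> 'r mat2 \<Rightarrow> 's mat2"
  where "mat2_map h (p, q, r, s) = (h p, h q, h r, h s)"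

text \<open>Carries freeness from the integers or from polynomials over to the field.\<close>

lemma wmat_hom:
  fixes h :: "'r::comm_ring_1 \<Rightarrow> 's::comm_ring_1"
  assumes "h 0 = 0" "h 1 = 1" "\<And>x y. h (x + y) = h x + h y" "\<And>x y. h (x * y) = h x * h y"
    "\<And>x. h (- x) = - h x"
  shows "wmat (h s) (h t) w = mat2_map h (wmat s t w)"
proof -
  have mul: "mmul (mat2_map h m) (mat2_map h n) = mat2_map h (mmul m n)" for m n
    by (cases m; cases n) (simp add: assms)
  have adj: "madj (mat2_map h m) = mat2_map h (madj m)" for m
    by (cases m) (simp add: assms)
  have "agen (h s) = mat2_map h (agen s)" "frame (h t) = mat2_map h (frame t)"
    by (simp_all add: agen_eq frame_def assms)
  then have "gen (h s) (h t) l = mat2_map h (gen s t l)" for l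
    by (simp add: gen_def bgen_def mul adj Let_def)
  then show ?thesis by (induction w) (auto simp: mul, simp add: mone_def assms)
qed

section \<open>Commuting stabilisers\<close>

text \<open>Modulo scalars a matrix is described by \<open>(p - s, q, r)\<close>; matrices commute
  when these vectors are parallel.\<close>

lemma mmul_commuteI:
  assumes "q * r' = q' * r" "(p - s) * q' = (p' - s') * q" "(p - s) * r' = (p' - s') * r"
  shows "mmul (p, q, r, s) (p', q', r', s') = mmul (p', q', r', s') (p, q, r, s)"
proof -
  have "p * q' + q * s' - (p' * q + q' * s) = (p - s) * q' - (p' - s') * q"
    "r * p' + s * r' - (r' * p + s' * r) = (p' - s') * r - (p - s) * r'"
    by (simp_all add: algebra_simps)
  then have "p * q' + q * s' = p' * q + q' * s" "r * p' + s * r' = r' * p + s' * r"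
    using assms(2,3) by simp_all
  then show ?thesis using assms(1) by (simp add: mult.commute)
qed

text \<open>Such a matrix is unipotent, and its difference from the identity is \<open>c\<close>
  times the nilpotent matrix with rows \<open>(- x * y, x * x)\<close> and
  \<open>(- y * y, x * y)\<close>, which depends on the vector only.\<close>

lemma fix_vectorD:
  fixes p q r s x y :: "'a::field"
  assumes "mdet (p, q, r, s) = 1" "mapp (p, q, r, s) (x, y) = (x, y)" "(x, y) \<noteq> (0, 0)"
  shows "\<exists>c. p - s = - 2 * c * x * y \<and> q = c * x * x \<and> r = - c * y * y"
proof -
  have det: "p * s - q * r = 1" and e: "(p - 1) * x + q * y = 0" "r * x + (s - 1) * y = 0"
    using assms by (auto simp: algebra_simps)
  \<comment> \<open>The adjugate of the matrix minus the identity is applied to the equations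
    \<open>e\<close>; as the determinant is one, the trace must be two.\<close>
  have "x * (p + s - 2) = x * (p * s - q * r - 1)
      - (s - 1) * ((p - 1) * x + q * y) + q * (r * x + (s - 1) * y)"
    "y * (p + s - 2) = y * (p * s - q * r - 1)
      - (p - 1) * (r * x + (s - 1) * y) + r * ((p - 1) * x + q * y)"
    by (simp_all add: algebra_simps)
  then have "x * (p + s - 2) = 0" "y * (p + s - 2) = 0" by (simp_all add: det e)
  then have "p + s = 2" using assms(3) by auto
  then have s: "s - 1 = - (p - 1)" "p - s = 2 * (p - 1)" by (simp_all add: algebra_simps)
  have e': "q * y = - (p - 1) * x" "r * x = (p - 1) * y"
    using e unfolding s(1) by (simp_all add: algebra_simps)
  show ?thesis
  proof (cases "x = 0")
    case False
    define c where "c = q / (x * x)"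
    have "q * y * y = - (r * x * x)" unfolding e' by (simp add: algebra_simps)
    then have "c * y * y = - r" using False by (simp add: c_def field_simps)
    moreover have "c * x * y = - (p - 1)" "c * x * x = q"
      using False e'(1) by (simp_all add: c_def field_simps)
    moreover from this have "- 2 * c * x * y = 2 * (p - 1)" by (simp add: mult.assoc)
    ultimately show ?thesis unfolding s(2) by (intro exI[of _ c]) simp
  next
    case True
    then have "y \<noteq> 0" using assms(3) by auto
    then show ?thesis using e' True unfolding s(2)
      by (intro exI[of _ "- r / (y * y)"]) (auto simp: field_simps)
  qed
qed

lemma commute_if_fix_vector:
  fixes m n :: "'a::field mat2"
  assumes "mdet m = 1" "mdet n = 1" "mapp m z = z" "mapp n z = z" "z \<noteq> (0, 0)"
  shows "mmul m n = mmul n m"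
proof -
  obtain p q r s where m: "m = (p, q, r, s)" by (cases m)
  obtain p' q' r' s' where n: "n = (p', q', r', s')" by (cases n)
  obtain x y where z: "z = (x, y)" by (cases z)
  obtain c where c: "p - s = - 2 * c * x * y" "q = c * x * x" "r = - c * y * y"
    using assms fix_vectorD[of p q r s x y] unfolding m z by blast
  obtain c' where c': "p' - s' = - 2 * c' * x * y" "q' = c' * x * x" "r' = - c' * y * y"
    using assms fix_vectorD[of p' q' r' s' x y] unfolding n z by blast
  show ?thesis unfolding m n by (rule mmul_commuteI; simp only: c c'; simp add: mult_ac)
qed

text \<open>Conjugation of the matrices modulo the scalar ones, where \<^term>\<open>(x, y, z)\<close> is the class of
  the matrix with first row \<^term>\<open>(x, y)\<close> and second row \<^term>\<open>(z, 0)\<close>.\<close>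

fun capp :: "'r::comm_ring_1 mat2 \<Rightarrow> 'r \<times> 'r \<times> 'r \<Rightarrow> 'r \<times> 'r \<times> 'r"
  where "capp (p, q, r, s) (x, y, z) =
    ((p * s + q * r) * x - 2 * p * r * y + 2 * q * s * z,
     - p * q * x + p * p * y - q * q * z,
     r * s * x - r * r * y + s * s * z)"

lemma capp_mmul: "capp (mmul m n) v = capp m (capp n v)"
  by (cases m; cases n; cases v) (simp add: algebra_simps)

lemma capp_mone [simp]: "capp mone v = v"
  by (cases v) (simp add: mone_def)

text \<open>If \<open>g M g\<inverse> = M + k\<close> with a scalar \<open>k\<close>, then taking traces in \<open>g M = M g + k g\<close> gives
  \<open>k tr g = 0\<close>.\<close>

lemma capp_fixD:
  fixes p q r s :: "'a::field"
  assumes "mdet (p, q, r, s) = 1" "capp (p, q, r, s) (x, y, z) = (x, y, z)" "p + s \<noteq> 0"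
    and "(x, y, z) \<noteq> (0, 0, 0)"
  shows "\<exists>c. p - s = c * x \<and> q = c * y \<and> r = c * z"
proof -
  \<comment> \<open>With \<open>M\<close> having rows \<open>(x, y)\<close> and
    \<open>(z, 0)\<close>, the diagonal entries of the conjugate of \<open>M\<close> are
    \<open>a\<close> and \<open>k\<close>. Since the last entry of \<open>M\<close> is zero,
    \<open>k\<close> is the scalar by which they differ.\<close>
  define k where "k = p * r * y - q * r * x - q * s * z"
  define a where "a = p * s * x + q * s * z - p * r * y"
  have det: "p * s - q * r = 1" and a: "a = x + k"
    and e: "p * p * y - p * q * x - q * q * z = y" "r * s * x - r * r * y + s * s * z = z"
    using assms by (auto simp: a_def k_def algebra_simps)
  have "(p * x + q * z) * (p * s - q * r) = a * p + (p * p * y - p * q * x - q * q * z) * r"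
    "p * y * (p * s - q * r) = a * q + (p * p * y - p * q * x - q * q * z) * s"
    "(r * x + s * z) * (p * s - q * r) = (r * s * x - r * r * y + s * s * z) * p + k * r"
    "r * y * (p * s - q * r) = (r * s * x - r * r * y + s * s * z) * q + k * s"
    by (simp_all add: a_def k_def algebra_simps)
  then have gM: "p * x + q * z = (x + k) * p + y * r" "p * y = (x + k) * q + y * s"
    "r * x + s * z = z * p + k * r" "r * y = z * q + k * s"
    unfolding det e a mult_1_right .
  have "k * (p + s) = 0" using gM(1,4) by (simp add: algebra_simps)
  then have "k = 0" using assms(3) by simp
  \<comment> \<open>Now the matrix commutes with the nonscalar \<open>M\<close>, hence is a scalar
    plus \<open>c\<close> times \<open>M\<close>.\<close>
  then have g: "q * z = r * y" "(p - s) * y = q * x" "(p - s) * z = r * x"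
    using gM by (simp_all add: algebra_simps)
  consider "x \<noteq> 0" | "y \<noteq> 0" | "z \<noteq> 0" using assms(4) by auto
  then show ?thesis
  proof cases
    case 1
    then show ?thesis using g by (intro exI[of _ "(p - s) / x"]) simp
  next
    case 2
    then show ?thesis using g by (intro exI[of _ "q / y"]) (simp add: eq_divide_eq mult_ac)
  next
    case 3
    then show ?thesis using g by (intro exI[of _ "r / z"]) (simp add: eq_divide_eq mult_ac)
  qed
qed

lemma commute_if_capp_fix:
  fixes m n :: "'a::field mat2"
  assumes "mdet m = 1" "mdet n = 1" "capp m v = v" "capp n v = v" "v \<noteq> (0, 0, 0)"
    and "fst m + snd (snd (snd m)) \<noteq> 0" "fst n + snd (snd (snd n)) \<noteq> 0"
  shows "mmul m n = mmul n m"
proof -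
  obtain p q r s where m: "m = (p, q, r, s)" by (cases m)
  obtain p' q' r' s' where n: "n = (p', q', r', s')" by (cases n)
  obtain x y z where v: "v = (x, y, z)" by (cases v)
  obtain c where c: "p - s = c * x" "q = c * y" "r = c * z"
    using assms capp_fixD[of p q r s x y z] unfolding m v fst_conv snd_conv by blast
  obtain c' where c': "p' - s' = c' * x" "q' = c' * y" "r' = c' * z"
    using assms capp_fixD[of p' q' r' s' x y z] unfolding n v fst_conv snd_conv by blast
  show ?thesis unfolding m n by (rule mmul_commuteI; simp only: c c'; simp add: mult_ac)
qed

definition free_pair :: "'a::field \<Rightarrow> 'a \<Rightarrow> bool"
  where "free_pair s t \<longleftrightarrow> (\<forall>w. reduced w \<longrightarrow> w \<noteq> [] \<longrightarrow> wmat s t w \<noteq> mone)"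

lemma red_commute_if_fix_vector:
  assumes "free_pair s t" "mapp (wmat s t u) z = z" "mapp (wmat s t w) z = z" "z \<noteq> (0, 0)"
  shows "red (u @ w) = red (w @ u)"
  using assms commute_if_fix_vector[of "wmat s t u" "wmat s t w" z]
  by (intro red_eq_if_wmat_eq[of s t]) (auto simp: free_pair_def wmat_append)

text \<open>An element of trace zero would have order dividing four.\<close>

lemma red_commute_if_capp_fix:
  assumes free: "free_pair s t" and v: "v \<noteq> (0, 0, 0)"
    and fixed: "capp (wmat s t u) v = v" "capp (wmat s t w) v = v"
  shows "red (u @ w) = red (w @ u)"
proof -
  have trace: "fst (wmat s t h) + snd (snd (snd (wmat s t h))) \<noteq> 0" if "red h \<noteq> []" for h
  proof
    assume zero: "fst (wmat s t h) + snd (snd (snd (wmat s t h))) = 0"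
    obtain p q r s' where m: "wmat s t h = (p, q, r, s')" by (cases "wmat s t h")
    \<comment> \<open>Cayley-Hamilton: trace zero and determinant one make the square equal to minus
      the identity.\<close>
    have "s' = - p" using zero by (simp add: m eq_neg_iff_add_eq_0 add.commute)
    moreover have "p * s' - q * r = 1" using mdet_wmat[of s t h] by (simp add: m)
    moreover have "p * p + q * r = - (p * (- p) - q * r)" by simp
    ultimately have "s' = - p" "p * p + q * r = - 1" by metis+
    then have "mmul (wmat s t h) (wmat s t h) = (-1, 0, 0, -1)"
      by (simp add: m mult.commute add.commute)
    moreover have "wmat s t (wpow 4 h) =
      mmul (mmul (wmat s t h) (wmat s t h)) (mmul (wmat s t h) (wmat s t h))"
      by (simp add: eval_nat_numeral wmat_append mmul_assoc)
    ultimately have "wmat s t (red (wpow 4 h)) = mone" by (simp add: wmat_red mone_def)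
    then have "red (wpow 4 h) = []" using free reduced_red by (auto simp: free_pair_def)
    then show False using red_wpow_eq_NilD[of 4 h] that by simp
  qed
  have "wmat s t (u @ w) = wmat s t (w @ u)"
  \<comment> \<open>In characteristic two the identity has trace zero as well, so trivial words are
    treated separately.\<close>
  proof (cases "red u = [] \<or> red w = []")
    case True
    then have "wmat s t u = mone \<or> wmat s t w = mone" by (metis wmat_red wmat_simps(1))
    then show ?thesis by (auto simp: wmat_append)
  next
    case False
    then show ?thesis
      using commute_if_capp_fix[OF _ _ fixed v] trace[of u] trace[of w] by (simp add: wmat_append)
  qed
  then show ?thesis using free by (intro red_eq_if_wmat_eq[of s t]) (auto simp: free_pair_def)
qed

section \<open>Block representations\<close>

text \<open>The indices outside \<^term>\<open>T\<close> are grouped into the pairs \<open>a\<close>, \<open>\<sigma> a\<close> with \<open>a \<in> P\<close>. If the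
  dimension is odd, then the three indices of \<^term>\<open>T\<close> carry the conjugation action.\<close>

locale blocks =
  fixes P T :: "'n::finite set" and \<sigma> :: "'n \<Rightarrow> 'n" and i j k :: 'n
  assumes pairs: "a \<notin> T \<Longrightarrow> \<sigma> a \<notin> T" "a \<notin> T \<Longrightarrow> \<sigma> a \<in> P \<longleftrightarrow> a \<notin> P" "a \<notin> T \<Longrightarrow> \<sigma> (\<sigma> a) = a"
    and triple: "T = {} \<or> T = {i, j, k} \<and> i \<noteq> j \<and> i \<noteq> k \<and> j \<noteq> k"
begin

definition pair :: "'n \<Rightarrow> 'a ^ 'n \<Rightarrow> 'a \<times> 'a"
  where "pair a x = (if a \<in> P then (x $ a, x $ \<sigma> a) else (x $ \<sigma> a, x $ a))"

definition trip :: "'a ^ 'n \<Rightarrow> 'a \<times> 'a \<times> 'a"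
  where "trip x = (x $ i, x $ j, x $ k)"

definition rep_fun :: "'a::field mat2 \<Rightarrow> 'a ^ 'n \<Rightarrow> 'a ^ 'n"
  where "rep_fun m x = (\<chi> a.
    if a \<in> T then (let (x1, x2, x3) = capp m (trip x) in if a = i then x1 else if a = j then x2 else x3)
    else if a \<in> P then fst (mapp m (pair a x)) else snd (mapp m (pair a x)))"

definition rep :: "'a::field mat2 \<Rightarrow> 'a ^ 'n ^ 'n"
  where "rep m = matrix (rep_fun m)"

lemma pair_\<sigma>: "a \<notin> T \<Longrightarrow> pair (\<sigma> a) x = pair a x"
  using pairs by (simp add: pair_def)

lemma pair_rep_fun: "a \<notin> T \<Longrightarrow> pair a (rep_fun m x) = mapp m (pair a x)"
  unfolding pair_def[of a "rep_fun m x"] using pairs pair_\<sigma>[of a x] by (simp add: rep_fun_def)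

lemma trip_rep_fun: "T \<noteq> {} \<Longrightarrow> trip (rep_fun m x) = capp m (trip x)"
proof -
  assume "T \<noteq> {}"
  then have "i \<in> T" "j \<in> T" "k \<in> T" "i \<noteq> j" "k \<noteq> i" "k \<noteq> j" using triple by auto
  then show ?thesis
    unfolding trip_def[of "rep_fun m x"] unfolding rep_fun_def by (simp add: split_beta)
qed

lemma vec_eqI:
  assumes "\<And>a. a \<notin> T \<Longrightarrow> pair a x = pair a y" "T \<noteq> {} \<Longrightarrow> trip x = trip y"
  shows "x = y"
proof -
  have "x $ a = y $ a" for a
    using assms(1)[of a] assms(2) triple by (cases "a \<in> T") (auto simp: pair_def trip_def split: if_splits)
  then show ?thesis by (simp add: vec_eq_iff)
qed

lemma rep_fun_mmul: "rep_fun (mmul m n) x = rep_fun m (rep_fun n x)"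
  by (rule vec_eqI) (simp_all add: pair_rep_fun trip_rep_fun mapp_mmul capp_mmul)

lemma rep_fun_mone: "rep_fun mone x = x"
  by (rule vec_eqI) (simp_all add: pair_rep_fun trip_rep_fun)

lemma linear_rep_fun: "Vector_Spaces.linear (*s) (*s) (rep_fun m :: 'a::field ^ 'n \<Rightarrow> _)"
proof -
  obtain p q r s where m: "m = (p, q, r, s)" by (cases m)
  show ?thesis
    unfolding Vector_Spaces.linear_iff
    by (auto simp: m vec.vector_space_axioms vec_eq_iff rep_fun_def pair_def trip_def algebra_simps)
qed

lemma rep_mult_vec: "rep m *v x = rep_fun m x"
  unfolding rep_def by (rule matrix_works[OF linear_rep_fun])

lemma rep_mmul: "rep (mmul m n) = rep m ** rep n"
  unfolding matrix_eq by (simp add: matrix_vector_mul_assoc[symmetric] rep_mult_vec rep_fun_mmul)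

lemma rep_mone: "rep mone = mat 1"
  unfolding matrix_eq by (simp add: rep_mult_vec rep_fun_mone)

lemma det_rep_mult: "mmul m n = mone \<Longrightarrow> det (rep m) * det (rep n) = 1"
  by (metis det_I det_mul rep_mmul rep_mone)

text \<open>The determinant of a representation has commutative values, so it is one on commutators;
  no block determinant is computed.\<close>

lemma det_rep_commutator:
  assumes "mdet m = 1" "mdet n = 1"
  shows "det (rep (mmul (mmul m n) (mmul (madj m) (madj n)))) = 1"
proof -
  have "det (rep m) * det (rep (madj m)) * (det (rep n) * det (rep (madj n))) = 1"
    using assms by (simp add: det_rep_mult mmul_madj)
  then show ?thesis by (simp add: rep_mmul det_mul mult_ac)
qed

lemma det_rep_gen:
  fixes c s t :: "'a::field"
  assumes c: "c \<noteq> 0" "c * c \<noteq> 1"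
  shows "det (rep (gen s t l)) = 1"
proof -
  let ?D = "(c, 0, 0, inverse c)"
  have D: "mdet ?D = 1" "mdet (upper z) = 1" "mdet (lower z) = 1" for z
    using c by (auto simp: upper_def lower_def)
  have c': "c * c - 1 \<noteq> 0" "inverse c * inverse c - 1 \<noteq> 0" using c by (auto simp: field_simps)
  \<comment> \<open>Conjugation by \<open>?D\<close> scales \<open>upper\<close> by
    \<open>c * c\<close> and \<open>lower\<close> by the inverse of that; the parameters are solved
    for so that the commutators become \<open>upper s\<close> and \<open>lower s\<close>.\<close>
  let ?x = "s / (c * c - 1)" and ?y = "s / (inverse c * inverse c - 1)"
  have eq: "c * c * ?x - ?x = s" "inverse c * inverse c * ?y - ?y = s"
    using c' by (metis left_diff_distrib mult_1 nonzero_mult_div_cancel_left times_divide_eq_right)+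
  define x y where xy: "x = ?x" "y = ?y"
  have "upper s = mmul (mmul ?D (upper x)) (mmul (madj ?D) (madj (upper x)))"
    "lower s = mmul (mmul ?D (lower y)) (mmul (madj ?D) (madj (lower y)))"
    using c eq unfolding xy[symmetric] by (simp_all add: upper_def lower_def algebra_simps)
  then have u: "det (rep (upper s)) = 1" and l: "det (rep (lower s)) = 1"
    using det_rep_commutator D by metis+
  have a: "det (rep (agen s)) = 1" by (simp add: agen_def rep_mmul det_mul u l)
  have "det (rep (frame t)) * det (rep (madj (frame t))) = 1"
    by (rule det_rep_mult) (simp add: mmul_madj)
  then have b: "det (rep (bgen s t)) = 1" by (simp add: bgen_def rep_mmul det_mul a)
  have "det (rep (madj m)) = 1" if "det (rep m) = 1" "mdet m = 1" for m :: "'a mat2"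
    using det_rep_mult[OF mmul_madj(1)[OF that(2)]] that by simp
  then show ?thesis using a b by (auto simp: gen_def Let_def bgen_def mdet_mmul)
qed

end

text \<open>An odd dimension is at least three here, so a triple can be split off; a bijection
  between two halves of the other indices gives the pairing.\<close>

lemma blocks_exists:
  assumes "CARD('n::finite) \<ge> 2"
  shows "\<exists>P T \<sigma> i j (k :: 'n). blocks P T \<sigma> i j k"
proof -
  obtain T :: "'n set" and i j k where T: "T = {} \<or> T = {i, j, k} \<and> i \<noteq> j \<and> i \<noteq> k \<and> j \<noteq> k"
    and ev: "even (card (- T))"
  proof (cases "even CARD('n)")
    case False
    then have "3 \<le> CARD('n)" using assms by (cases "CARD('n) = 2") auto
    then obtain T :: "'n set" where T: "card T = 3" by (metis obtain_subset_with_card_n)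
    then obtain i j k where "T = {i, j, k}" "i \<noteq> j" "i \<noteq> k" "j \<noteq> k" by (auto simp: card_3_iff)
    moreover have "card (- T) = CARD('n) - 3" using T by (simp add: Compl_eq_Diff_UNIV card_Diff_subset)
    ultimately show ?thesis using that[of T i j k] False by auto
  qed (use that[of "{}"] in auto)
  obtain P where P: "P \<subseteq> - T" "card P = card (- T) div 2"
    using obtain_subset_with_card_n[of "card (- T) div 2" "- T"] by auto
  have "card (- T - P) = card P" using P ev by (subst card_Diff_subset) auto
  then obtain h where h: "bij_betw h P (- T - P)"
    using finite_same_card_bij[of P "- T - P"] by auto
  define \<sigma> where "\<sigma> a = (if a \<in> P then h a else inv_into P h a)" for a
  have hP: "h a \<notin> T" "h a \<notin> P" "inv_into P h (h a) = a" if "a \<in> P" for a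
    using h that by (auto simp: bij_betw_def)
  have hQ: "inv_into P h a \<in> P" "inv_into P h a \<notin> T" "h (inv_into P h a) = a"
    if "a \<notin> T" "a \<notin> P" for a
  proof -
    have "a \<in> h ` P" using h that by (auto simp: bij_betw_def)
    then show "inv_into P h a \<in> P" "h (inv_into P h a) = a"
      by (auto intro: inv_into_into f_inv_into_f)
    then show "inv_into P h a \<notin> T" using P(1) by blast
  qed
  have "blocks P T \<sigma> i j k"
    by unfold_locales (use T in \<open>auto simp: \<sigma>_def hP hQ\<close>)
  then show ?thesis by blast
qed

section \<open>Congruence subgroups\<close>

locale ring_ideal =
  fixes R I :: "'a::comm_ring_1 set"
  assumes R_1: "1 \<in> R" and R_diff: "\<lbrakk>x \<in> R; y \<in> R\<rbrakk> \<Longrightarrow> x - y \<in> R"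
    and R_mult: "\<lbrakk>x \<in> R; y \<in> R\<rbrakk> \<Longrightarrow> x * y \<in> R"
    and I_subset: "I \<subseteq> R" and I_0: "0 \<in> I" and I_diff: "\<lbrakk>x \<in> I; y \<in> I\<rbrakk> \<Longrightarrow> x - y \<in> I"
    and I_mult: "\<lbrakk>x \<in> R; y \<in> I\<rbrakk> \<Longrightarrow> x * y \<in> I"
begin

lemma I_minus: "x \<in> I \<Longrightarrow> - x \<in> I"
  using I_diff[OF I_0] by simp

lemma I_add: "\<lbrakk>x \<in> I; y \<in> I\<rbrakk> \<Longrightarrow> x + y \<in> I"
  using I_diff[OF _ I_minus] by simp

lemma R_0: "0 \<in> R"
  using R_diff[OF R_1 R_1] by simp

lemma R_minus: "x \<in> R \<Longrightarrow> - x \<in> R"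
  using R_diff[OF R_0] by simp

lemma R_add: "\<lbrakk>x \<in> R; y \<in> R\<rbrakk> \<Longrightarrow> x + y \<in> R"
  using R_diff[OF _ R_minus] by simp

lemma R_2: "2 \<in> R"
  using R_add[OF R_1 R_1] by simp

lemma I_in_R: "x \<in> I \<Longrightarrow> x \<in> R"
  using I_subset by auto

lemmas closed = I_0 I_add I_diff I_minus I_mult R_0 R_1 R_2 R_add R_diff R_minus R_mult I_in_R

definition congruent_one :: "'a mat2 \<Rightarrow> bool"
  where "congruent_one m \<longleftrightarrow> (\<exists>p q r d. p \<in> I \<and> q \<in> I \<and> r \<in> I \<and> d \<in> I \<and> m = (1 + p, q, r, 1 + d))"

text \<open>Conjugation by a matrix over \<open>R\<close> preserves congruence to the identity, so
  only \<open>s\<close> has to be small, not \<open>t\<close>.\<close>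

lemma congruent_one_gen:
  assumes s: "s \<in> I" and t: "t \<in> R"
  shows "congruent_one (gen s t l)"
proof -
  have "agen s = (1 + s * s, s, s, 1 + 0)" by (simp add: agen_eq)
  moreover have "bgen s t = (1 + ((1 + t) * s - 1) * s, (1 + 2 * t - t * (1 + t) * s) * s,
      s * s, 1 + (1 - t * s) * s)"
    by (simp add: bgen_def agen_eq frame_def algebra_simps)
  ultimately have "congruent_one (agen s)" "congruent_one (bgen s t)"
    unfolding congruent_one_def using closed s t by (metis (no_types))+
  moreover have "congruent_one (madj m)" if "congruent_one m" for m
    using that I_minus unfolding congruent_one_def by (metis (no_types) madj.simps)
  ultimately show ?thesis by (simp add: gen_def Let_def)
qed

lemma capp_congruent_one:
  assumes m: "congruent_one m" and R: "x \<in> R" "y \<in> R" "z \<in> R"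
    and eq: "capp m (x, y, z) = (x', y', z')"
  shows "x' - x \<in> I \<and> y' - y \<in> I \<and> z' - z \<in> I"
proof -
  obtain p q r d where I: "p \<in> I" "q \<in> I" "r \<in> I" "d \<in> I" and m: "m = (1 + p, q, r, 1 + d)"
    using m by (auto simp: congruent_one_def)
  \<comment> \<open>Each summand is arranged to have its last factor in the ideal, as
    \<open>I_mult\<close> expects.\<close>
  have "x' - x = x * p + (x + x * p) * d + (x * q - 2 * (1 + p) * y) * r + 2 * (1 + d) * z * q"
    "y' - y = (2 * y + y * p) * p - (1 + p) * x * q - z * q * q"
    "z' - z = (2 * z + z * d) * d + (1 + d) * x * r - y * r * r"
    using eq by (auto simp: m algebra_simps)
  moreover have "x * p + (x + x * p) * d + (x * q - 2 * (1 + p) * y) * r + 2 * (1 + d) * z * q \<in> I"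
    "(2 * y + y * p) * p - (1 + p) * x * q - z * q * q \<in> I"
    "(2 * z + z * d) * d + (1 + d) * x * r - y * r * r \<in> I"
    using I R by (intro I_add I_diff I_mult R_add R_diff R_mult R_1 R_2; simp add: I_in_R)+
  ultimately show ?thesis by simp
qed

end

lemma (in blocks) rep_congruent_one:
  fixes m :: "'a::field mat2"
  assumes RI: "ring_ideal R I" and m: "ring_ideal.congruent_one I m"
  shows "(rep m - mat 1) $ a $ b \<in> I"
proof -
  interpret ring_ideal R I by (rule RI)
  let ?e = "axis b 1 :: 'a ^ 'n"
  have e: "?e $ c \<in> R" for c by (simp add: axis_def R_0 R_1)
  have "(rep_fun m ?e - ?e) $ a \<in> I"
  proof (cases "a \<in> T")
    case True
    obtain x y z where xyz: "capp m (trip ?e) = (x, y, z)" by (cases "capp m (trip ?e)")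
    then have "x - ?e $ i \<in> I \<and> y - ?e $ j \<in> I \<and> z - ?e $ k \<in> I"
      using capp_congruent_one[OF m e e e] by (simp add: trip_def)
    then show ?thesis
      using True triple xyz by (auto simp: rep_fun_def)
  next
    case False
    obtain p q r d where I: "p \<in> I" "q \<in> I" "r \<in> I" "d \<in> I" and m: "m = (1 + p, q, r, 1 + d)"
      using m by (auto simp: congruent_one_def)
    have "?e $ a * p + ?e $ \<sigma> a * q \<in> I" "?e $ \<sigma> a * r + ?e $ a * d \<in> I"
      using I by (intro I_add I_mult e; simp)+
    then show ?thesis using False by (simp add: rep_fun_def m pair_def algebra_simps)
  qed
  then show ?thesis by (simp add: rep_def matrix_def mat_def axis_def if_distrib eq_commute)
qed

section \<open>Local commutativity on nonzero vectors\<close>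

lemma (in blocks) exists_nonzero_block:
  assumes "x \<noteq> 0"
  shows "(\<exists>a. a \<notin> T \<and> pair a x \<noteq> (0, 0)) \<or> (T \<noteq> {} \<and> trip x \<noteq> (0, 0, 0))"
proof (rule ccontr)
  assume "\<not> ?thesis"
  moreover have "pair a (0 :: 'a ^ 'n) = (0, 0)" "trip (0 :: 'a ^ 'n) = (0, 0, 0)" for a
    by (simp_all add: pair_def trip_def)
  ultimately have "x = 0" by (intro vec_eqI) auto
  then show False using assms by simp
qed

lemma (in blocks) rep_word:
  "foldr (\<lambda>l. (*v) (rep (gen s t l))) w x = rep_fun (wmat s t w) x"
  by (induction w) (simp_all add: rep_fun_mone rep_fun_mmul rep_mult_vec)

lemma (in blocks) rep_locally_commutative:
  fixes s t :: "'a::field" and x :: "'a ^ 'n"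
  assumes "free_pair s t" "x \<noteq> 0"
    and fixed: "foldr (\<lambda>l. (*v) (rep (gen s t l))) u x = x" "foldr (\<lambda>l. (*v) (rep (gen s t l))) w x = x"
  shows "red (u @ w) = red (w @ u)"
  using exists_nonzero_block[OF assms(2)]
proof
  assume "\<exists>a. a \<notin> T \<and> pair a x \<noteq> (0, 0)"
  then show ?thesis
    using fixed red_commute_if_fix_vector[OF assms(1)] unfolding rep_word by (metis pair_rep_fun)
next
  assume "T \<noteq> {} \<and> trip x \<noteq> (0, 0, 0)"
  then show ?thesis
    using fixed red_commute_if_capp_fix[OF assms(1)] unfolding rep_word by (metis trip_rep_fun)
qed

section \<open>The characteristic of the residue field\<close>

context nonarch_valuation
begin

lemma val_0 [simp]: "v 0 = 0"
  using val_eq_0_iff by simp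

lemma val_diff: "v (x - y) \<le> max (v x) (v y)"
  using val_ultrametric[of x "- y"] by (simp add: val_minus)

lemma val_power: "v (x ^ n) = v x ^ n"
  by (induction n) (auto simp: val_1 val_mult)

lemma val_of_nat_le_1: "v (of_nat n) \<le> 1"
  using val_sum_le[of "{..<n}" 1 "\<lambda>_. 1"] by (simp add: val_1)

lemma val_of_int_of_nat: "v (of_int z) = v (of_nat (nat \<bar>z\<bar>))"
  by (cases "z \<ge> 0") (simp_all add: val_minus)

lemma val_Ints_le_1: "x \<in> \<int> \<Longrightarrow> v x \<le> 1"
  by (metis Ints_cases val_of_int_of_nat val_of_nat_le_1)

text \<open>The multiples of the unit are the cosets of natural numbers, that is, the open unit
  balls around them, and such a ball is the zero coset exactly when its centre has valuation below
  one.\<close>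

lemma ring_char_residue_field: "ring_char (residue_field v) = Gcd {n. v (of_nat n) < 1}"
proof -
  let ?S = "residue_field v"
  let ?coset = "\<lambda>c. {y. v (y - c) < 1}"
  have add: "a \<oplus>\<^bsub>?S\<^esub> b = {x + y | x y. x \<in> a \<and> y \<in> b}" for a b
    by (auto simp: residue_field_def FactRing_def set_add_defs integer_ring_def)
  have one: "\<one>\<^bsub>?S\<^esub> = ?coset 1"
  proof -
    have "(\<Union>h\<in>{x. v x < 1}. {h + 1}) = ?coset 1"
    proof (intro subset_antisym subsetI)
      fix x assume "x \<in> ?coset 1"
      then show "x \<in> (\<Union>h\<in>{x. v x < 1}. {h + 1})" by (intro UN_I[of "x - 1"]) auto
    qed auto
    then show ?thesis
      by (simp add: residue_field_def FactRing_def a_r_coset_def' integer_ring_def max_ideal_of_def)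
  qed
  have zero: "\<zero>\<^bsub>?S\<^esub> = ?coset 0"
    by (simp add: residue_field_def FactRing_def max_ideal_of_def)
  have sum: "{x + y | x y. x \<in> ?coset c \<and> y \<in> ?coset d} = ?coset (c + d)" (is "?A = ?B") for c d
  proof
    have "v (x + y - (c + d)) < 1" if "v (x - c) < 1" "v (y - d) < 1" for x y
      using that val_ultrametric[of "x - c" "y - d"] by (simp add: algebra_simps)
    then show "?A \<subseteq> ?B" by auto
    have "\<exists>y z. x = y + z \<and> v (y - c) < 1 \<and> v (z - d) < 1" if "v (x - (c + d)) < 1" for x
      using that by (intro exI[of _ "x - d"] exI[of _ d]) (simp add: algebra_simps)
    then show "?B \<subseteq> ?A" by auto
  qed
  have "add_pow ?S n \<one>\<^bsub>?S\<^esub> = ?coset (of_nat n)" for n :: nat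
  proof (induction n)
    case 0
    then show ?case by (simp add: add_pow_def nat_pow_def zero)
  next
    case (Suc n)
    have "add_pow ?S (Suc n) \<one>\<^bsub>?S\<^esub> = add_pow ?S n \<one>\<^bsub>?S\<^esub> \<oplus>\<^bsub>?S\<^esub> \<one>\<^bsub>?S\<^esub>"
      by (simp add: add_pow_def nat_pow_def)
    also have "\<dots> = ?coset (of_nat (Suc n))"
      unfolding add Suc.IH unfolding one using sum[of "of_nat n" 1] by (simp add: add.commute)
    finally show ?case .
  qed
  moreover have "?coset c = ?coset 0 \<longleftrightarrow> v c < 1" for c
  proof
    assume "?coset c = ?coset 0"
    moreover have "c \<in> ?coset c" by simp
    ultimately show "v c < 1" by (metis diff_zero mem_Collect_eq)
  next
    assume "v c < 1"
    then have "v (y - c) < 1 \<longleftrightarrow> v y < 1" for y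
      using val_diff[of y c] val_ultrametric[of "y - c" c] by auto
    then show "?coset c = ?coset 0" by simp
  qed
  ultimately show ?thesis unfolding ring_char_def zero by simp
qed

text \<open>By Bezout the element has an inverse that is again the image of a natural number, and
  both have valuation at most one.\<close>

lemma val_of_nat_positive_char:
  assumes "CHAR('a) > 0" "of_nat n \<noteq> (0::'a)"
  shows "v (of_nat n) = 1"
proof -
  have n: "n \<noteq> 0" using assms(2) by (cases n) auto
  obtain d x y where d: "d dvd n" "d dvd CHAR('a)" "n * x = CHAR('a) * y + d"
    using bezout_add_strong_nat[OF n, of "CHAR('a)"] by blast
  obtain e where e: "CHAR('a) = d * e" using d(2) by (auto elim: dvdE)
  have "of_nat d \<noteq> (0::'a)" using assms(2) d(1) by (auto simp: of_nat_eq_0_iff_char_dvd)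
  moreover have "of_nat d * of_nat e = (0::'a)" by (simp flip: of_nat_mult e)
  ultimately have "CHAR('a) dvd e" by (simp flip: of_nat_eq_0_iff_char_dvd)
  then have "d = 1" using e assms(1) by (metis dvd_antisym dvd_mult_cancel2 dvd_triv_right)
  then have "of_nat n * of_nat x = (1::'a)"
    using arg_cong[OF d(3), of "of_nat :: nat \<Rightarrow> 'a"] by simp
  then have "v (of_nat n) * v (of_nat x) = 1" by (metis val_1 val_mult)
  moreover have "v (of_nat n) * v (of_nat x) \<le> v (of_nat n) * 1"
    by (intro mult_left_mono val_of_nat_le_1 val_nonneg)
  ultimately show ?thesis using val_of_nat_le_1[of n] by linarith
qed

lemma mixed_characteristicD:
  assumes "CHAR('a) \<noteq> ring_char (residue_field v)"
  shows "CHAR('a) = 0" "\<exists>n>0. v (of_nat n) < 1"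
proof -
  show 0: "CHAR('a) = 0"
  proof (rule ccontr)
    assume "CHAR('a) \<noteq> 0"
    \<comment> \<open>In positive characteristic only the multiples of it have valuation below one,
      so the two characteristics would agree.\<close>
    then have "{n. v (of_nat n) < 1} = {n. CHAR('a) dvd n}"
      using val_of_nat_positive_char by (fastforce simp flip: of_nat_eq_0_iff_char_dvd)
    moreover have "Gcd {n. CHAR('a) dvd n} = CHAR('a)"
      by (intro dvd_antisym Gcd_dvd Gcd_greatest) auto
    ultimately show False using assms by (simp add: ring_char_residue_field)
  qed
  then have "Gcd {n. v (of_nat n) < 1} \<noteq> 0" using assms by (simp add: ring_char_residue_field)
  then show "\<exists>n>0. v (of_nat n) < 1" by (auto simp: Gcd_0_iff)
qed

lemma equal_characteristicD:
  assumes "CHAR('a) = ring_char (residue_field v)" "z \<in> \<int>" "z \<noteq> 0"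
  shows "v z = 1"
proof -
  have nat: "v (of_nat n) = 1" if "of_nat n \<noteq> (0::'a)" for n
  proof (cases "CHAR('a) = 0")
    case False
    then show ?thesis using val_of_nat_positive_char that by simp
  next
    case True
    then have "{n. v (of_nat n) < 1} \<subseteq> {0}" using assms(1) by (simp add: ring_char_residue_field)
    moreover have "n \<noteq> 0" using that by (cases n) auto
    ultimately have "\<not> v (of_nat n) < 1" by auto
    then show ?thesis using val_of_nat_le_1[of n] by simp
  qed
  obtain k where "z = of_int k" using assms(2) by (auto elim: Ints_cases)
  then show ?thesis
    using assms(3) nat[of "nat \<bar>k\<bar>"] val_of_int_of_nat[of k] val_eq_0_iff by (metis zero_neq_one)
qed

end

section \<open>Small free pairs in the coefficient ring\<close>

lemma ping_pong_int:
  assumes "s \<ge> (8::int)"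
  shows "ping_pong (\<lambda>z. real_of_int \<bar>z\<bar>) s 2"
  using assms by unfold_locales (auto simp: abs_mult)

text \<open>The base four fits the bounds: \<open>N t\<close> is 4 and \<open>N s\<close> is 16,
  above the required 12.\<close>

lemma ping_pong_poly:
  "ping_pong (\<lambda>p. if p = 0 then 0 else 4 ^ degree p) ([:0, 1:]\<^sup>2 :: 'a::field poly) [:0, 1:]"
proof
  fix p q :: "'a poly"
  let ?N = "\<lambda>p :: 'a poly. if p = 0 then 0 else 4 ^ degree p :: real"
  show "?N (p * q) = ?N p * ?N q" by (simp add: degree_mult_eq power_add)
  show "?N (p + q) \<le> ?N p + ?N q"
  proof (cases "p = 0 \<or> q = 0")
    case False
    have "(4::real) ^ degree (p + q) \<le> 4 ^ max (degree p) (degree q)"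
      by (intro power_increasing degree_add_le_max) simp
    also have "\<dots> \<le> 4 ^ degree p + 4 ^ degree q" by (simp add: max_def)
    finally show ?thesis using False by auto
  qed auto
qed (auto simp: degree_power_eq)

text \<open>Evaluation at \<open>t\<close> is injective only on polynomials over the prime ring, see
  \<open>poly_Ints_eq_0\<close>.\<close>

lemma Ints_coeff_wmat:
  fixes s t :: "'a::field poly"
  assumes "\<And>i. coeff s i \<in> \<int>" "\<And>i. coeff t i \<in> \<int>" "wmat s t w = (p, q, r, d)"
  shows "coeff p i \<in> \<int> \<and> coeff q i \<in> \<int> \<and> coeff r i \<in> \<int> \<and> coeff d i \<in> \<int>"
proof -
  let ?R = "{p. \<forall>i. coeff p i \<in> (\<int> :: 'a set)}"
  \<comment> \<open>With the whole ring as the ideal, \<open>congruent_one\<close> just says that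
    the entries lie in the ring.\<close>
  interpret ring_ideal ?R ?R
    by unfold_locales (auto simp: coeff_1 coeff_mult)
  have "\<exists>p q r d. p \<in> ?R \<and> q \<in> ?R \<and> r \<in> ?R \<and> d \<in> ?R \<and> wmat s t w = (p, q, r, d)"
  proof (induction w)
    case Nil
    show ?case unfolding wmat_simps mone_def using R_0 R_1 by blast
  next
    case (Cons l w)
    obtain p q r d where w: "wmat s t w = (p, q, r, d)" and 1: "p \<in> ?R" "q \<in> ?R" "r \<in> ?R" "d \<in> ?R"
      using Cons by blast
    have "congruent_one (gen s t l)" by (rule congruent_one_gen) (use assms in auto)
    then obtain p' q' r' d' where l: "gen s t l = (1 + p', q', r', 1 + d')"
      and 2: "p' \<in> ?R" "q' \<in> ?R" "r' \<in> ?R" "d' \<in> ?R"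
      unfolding congruent_one_def by blast
    show ?case
      unfolding wmat_simps l w mmul.simps
      by (intro exI conjI; (rule refl)?; intro R_add R_mult R_1 1 2)
  qed
  then show ?thesis using assms(3) by auto
qed

context nonarch_valuation
begin

text \<open>A nonzero constant term has valuation one and cannot cancel the other terms, whose sum
  has valuation below one; then divide by \<open>t\<close> and repeat. So \<open>t\<close> is
  transcendental over the prime ring.\<close>

lemma poly_Ints_eq_0:
  assumes triv: "\<And>z. z \<in> \<int> \<Longrightarrow> z \<noteq> 0 \<Longrightarrow> v z = 1" and t: "t \<noteq> 0" "v t < 1"
    and p: "\<And>i. coeff p i \<in> \<int>" "poly p t = 0"
  shows "p = 0"
  using p
proof (induction p)
  case (pCons c p)
  have c: "c \<in> \<int>" and coeffs: "\<And>i. coeff p i \<in> \<int>"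
    using pCons.prems(1)[of 0] pCons.prems(1)[of "Suc i" for i] by simp_all
  have "v (poly p t) \<le> 1"
    using coeffs
  proof (induction p)
    case (pCons b q)
    have "b \<in> \<int>" and "\<And>i. coeff q i \<in> \<int>"
      using pCons.prems[of 0] pCons.prems[of "Suc i" for i] by simp_all
    then have "v b \<le> 1" "v (t * poly q t) \<le> 1"
      using val_Ints_le_1 pCons.IH t(2) val_nonneg by (auto simp: val_mult intro: mult_le_one)
    then show ?case using val_ultrametric[of b "t * poly q t"] by simp
  qed simp
  then have "v (t * poly p t) < 1"
    using mult_left_mono[of "v (poly p t)" 1 "v t"] val_nonneg[of t] t(2) by (simp add: val_mult)
  moreover have "t * poly p t = - c"
    using pCons.prems(2) by (simp add: eq_neg_iff_add_eq_0 add.commute)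
  ultimately have "c = 0" using triv[OF c] by (cases "c = 0") (auto simp: val_minus)
  moreover from this have "p = 0"
    using pCons.IH[OF coeffs] pCons.prems(2) t(1) by simp
  ultimately show ?case by simp
qed simp

lemma free_pair_mixed:
  assumes "CHAR('a) = 0" and s: "(s::int) \<ge> 8"
  shows "free_pair (of_int s :: 'a) 2"
  unfolding free_pair_def
proof (intro allI impI notI)
  fix w assume w: "reduced w" "w \<noteq> []" and one: "wmat (of_int s :: 'a) 2 w = mone"
  interpret ping_pong "\<lambda>z. real_of_int \<bar>z\<bar>" s 2 by (rule ping_pong_int[OF s])
  obtain p q r d where m: "wmat s 2 w = (p, q, r, d)" by (cases "wmat s 2 w")
  have inj: "z = 0" if "of_int z = (0 :: 'a)" for z
  proof -
    have "of_nat (nat \<bar>z\<bar>) = (0 :: 'a)" using that by (cases "z \<ge> 0") auto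
    then have "CHAR('a) dvd nat \<bar>z\<bar>" unfolding of_nat_eq_0_iff_char_dvd .
    then show ?thesis using assms(1) by simp
  qed
  have "wmat (of_int s :: 'a) (of_int 2) w = mat2_map of_int (wmat s 2 w)" by (rule wmat_hom) auto
  then have "of_int (p - 1) = (0::'a)" "of_int q = (0::'a)" "of_int r = (0::'a)" "of_int (d - 1) = (0::'a)"
    using one by (simp_all add: m mone_def)
  then have "p - 1 = 0" "q = 0" "r = 0" "d - 1 = 0" using inj by blast+
  then have "wmat s 2 w = mone" by (simp add: m mone_def)
  then show False using wmat_neq_mone[OF w] by simp
qed

lemma free_pair_equal:
  assumes triv: "\<And>z. z \<in> \<int> \<Longrightarrow> z \<noteq> 0 \<Longrightarrow> v z = 1" and t: "t \<noteq> 0" "v t < 1"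
  shows "free_pair (t\<^sup>2) t"
  unfolding free_pair_def
proof (intro allI impI notI)
  fix w assume w: "reduced w" "w \<noteq> []" and one: "wmat (t\<^sup>2) t w = mone"
  let ?X = "[:0, 1:] :: 'a poly"
  interpret ping_pong "\<lambda>p. if p = 0 then 0 else 4 ^ degree p" "?X\<^sup>2" ?X by (rule ping_pong_poly)
  obtain p q r d where m: "wmat (?X\<^sup>2) ?X w = (p, q, r, d)" by (cases "wmat (?X\<^sup>2) ?X w")
  have X: "coeff ?X i \<in> \<int>" "coeff (?X\<^sup>2) i \<in> \<int>" for i
    by (auto simp: coeff_pCons power2_eq_square split: nat.split)
  have "wmat (poly (?X\<^sup>2) t) (poly ?X t) w = mat2_map (\<lambda>p. poly p t) (wmat (?X\<^sup>2) ?X w)"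
    by (rule wmat_hom) auto
  then have "poly (p - 1) t = 0" "poly q t = 0" "poly r t = 0" "poly (d - 1) t = 0"
    using one by (simp_all add: m mone_def)
  moreover have "coeff (p - 1) i \<in> \<int>" "coeff q i \<in> \<int>" "coeff r i \<in> \<int>" "coeff (d - 1) i \<in> \<int>" for i
    using Ints_coeff_wmat[OF X(2) X(1) m, of i] by (auto simp: coeff_1)
  ultimately have "p - 1 = 0" "q = 0" "r = 0" "d - 1 = 0"
    using poly_Ints_eq_0[OF triv t] by blast+
  then have "wmat (?X\<^sup>2) ?X w = mone" by (simp add: m mone_def)
  then show False using wmat_neq_mone[OF w] by simp
qed

lemma nontrivial_obtains:
  assumes "nontrivial_valuation v"
  obtains t where "t \<noteq> 0" "v t < 1"
proof -
  have "\<exists>y. y \<noteq> 0 \<and> v y \<noteq> 1"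
  proof (rule ccontr)
    assume "\<not> ?thesis"
    then have "v ` (UNIV - {0}) = (\<lambda>_. 1) ` (UNIV - {0 :: 'a})" by (intro image_cong) auto
    moreover have "(1::'a) \<in> UNIV - {0}" by simp
    ultimately show False using assms unfolding nontrivial_valuation_def by (metis image_constant)
  qed
  then obtain y where y: "y \<noteq> 0" "v y \<noteq> 1" by blast
  have "v (y * inverse y) = 1" using y(1) val_1 by simp
  then have "v y * v (inverse y) = 1" unfolding val_mult .
  then have "v y < 1 \<or> v (inverse y) < 1"
    using y(2) mult_left_mono[of 1 "v (inverse y)" "v y"] val_nonneg[of y] by linarith
  then show thesis using that[of y] that[of "inverse y"] y(1) by auto
qed

lemma exists_small_free_pair:
  assumes "nontrivial_valuation v" "\<delta> > 0"
  shows "\<exists>s\<in>coefficient_ring v. \<exists>t\<in>coefficient_ring v. v s < \<delta> \<and> free_pair s t"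
proof (cases "CHAR('a) = ring_char (residue_field v)")
  case False
  obtain n where n: "n > 0" "v (of_nat n) < 1" using mixed_characteristicD(2)[OF False] by blast
  then have "n \<noteq> 1" using val_1 by auto
  then have "n \<ge> 2" using n(1) by simp
  obtain k where k: "v (of_nat n) ^ k < \<delta>"
    using real_arch_pow_inv[OF assms(2) n(2)] by blast
  \<comment> \<open>The extra exponent makes the integer at least 8, as ping-pong over the integers
    requires.\<close>
  let ?s = "int n ^ (k + 3)"
  have "(2::int) ^ 3 \<le> 2 ^ (k + 3)" by (intro power_increasing) auto
  also have "\<dots> \<le> ?s" using \<open>n \<ge> 2\<close> by (intro power_mono) auto
  finally have "free_pair (of_int ?s :: 'a) 2"
    using mixed_characteristicD(1)[OF False] by (intro free_pair_mixed) auto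
  moreover have "v (of_int ?s) \<le> v (of_nat n) ^ k"
    using n(2) val_nonneg by (simp add: val_power power_decreasing)
  ultimately show ?thesis
    using False k by (intro bexI[of _ "of_int ?s"] bexI[of _ 2]) (auto simp: coefficient_ring_def)
next
  case True
  obtain y where y: "y \<noteq> 0" "v y < 1" using nontrivial_obtains[OF assms(1)] by blast
  obtain k where k: "v y ^ k < \<delta>" using real_arch_pow_inv[OF assms(2) y(2)] by blast
  \<comment> \<open>The successor keeps the valuation of \<open>?t\<close> below one even if
    \<open>k\<close> is zero.\<close>
  let ?t = "y ^ (k + 1)"
  have t: "?t \<noteq> 0" "v ?t < 1" "v (?t\<^sup>2) \<le> v y ^ k"
    using y val_nonneg[of y] power_decreasing[of k "(k + 1) * 2" "v y"] power_less_one_iff[of "v y" "k + 1"]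
    by (simp_all only: val_power power_mult[symmetric]) auto
  have "free_pair (?t\<^sup>2) ?t"
    by (rule free_pair_equal[OF equal_characteristicD[OF True] t(1,2)])
  moreover have "v (?t\<^sup>2) \<le> 1" using t(2) val_nonneg by (simp add: val_power power_le_one)
  ultimately show ?thesis
    using True t k
    by (intro bexI[of _ "?t\<^sup>2"] bexI[of _ ?t]) (auto simp: coefficient_ring_def integers_of_def)
qed

lemma coefficient_ring_subset: "coefficient_ring v \<subseteq> {x. v x \<le> 1}"
  using val_Ints_le_1 by (auto simp: coefficient_ring_def integers_of_def)

lemma ring_ideal_small:
  assumes "\<delta> > 0"
  shows "ring_ideal (coefficient_ring v) {x \<in> coefficient_ring v. v x < \<delta>}"
proof -
  have *: "1 \<in> coefficient_ring v" "x - y \<in> coefficient_ring v" "x * y \<in> coefficient_ring v"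
    if "x \<in> coefficient_ring v" "y \<in> coefficient_ring v" for x y
    using that val_diff[of x y] val_nonneg
    by (auto simp: coefficient_ring_def integers_of_def val_1 val_mult intro: mult_le_one)
  have one: "1 \<in> coefficient_ring v" by (simp add: coefficient_ring_def integers_of_def val_1)
  show ?thesis
  proof
    fix x y assume x: "x \<in> coefficient_ring v" and y: "y \<in> {x \<in> coefficient_ring v. v x < \<delta>}"
    have "v x * v y \<le> 1 * v y"
      using x coefficient_ring_subset val_nonneg by (intro mult_right_mono) auto
    then show "x * y \<in> {x \<in> coefficient_ring v. v x < \<delta>}" using *[OF x] y by (auto simp: val_mult)
  next
    fix x y assume xy: "x \<in> {x \<in> coefficient_ring v. v x < \<delta>}" "y \<in> {x \<in> coefficient_ring v. v x < \<delta>}"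
    then have "v (x - y) < \<delta>" using val_diff[of x y] by auto
    then show "x - y \<in> {x \<in> coefficient_ring v. v x < \<delta>}" using xy *(2) by simp
  next
    show "0 \<in> {x \<in> coefficient_ring v. v x < \<delta>}" using *(2)[OF one one] assms by simp
  qed (use * one in auto)
qed

section \<open>Invariant balls\<close>

lemma closed_ball_iff: "y \<in> closed_ball v x r \<longleftrightarrow> (\<forall>i. v ((y - x) $ i) \<le> r)"
  by (auto simp: closed_ball_def vec_norm_def)

lemma open_ball_iff: "y \<in> open_ball v x r \<longleftrightarrow> (\<forall>i. v ((y - x) $ i) < r)"
  by (auto simp: open_ball_def vec_norm_def)

text \<open>Split the displacement of \<open>A *v y\<close> from the centre: \<open>A\<close> does
  not increase the norm of \<open>y - x\<close>, and it moves the centre itself by less than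
  \<open>r\<close>. The ultrametric inequality combines the two.\<close>

lemma ball_invariant:
  fixes A :: "'a ^ 'n ^ 'n" and x y :: "'a ^ 'n"
  assumes B: "B = closed_ball v x r \<or> B = open_ball v x r" and r: "r > 0" and y: "y \<in> B"
    and A: "\<And>i j. v (A $ i $ j) \<le> 1" "\<And>i j. v ((A - mat 1) $ i $ j) < \<delta>" and \<delta>: "\<delta> * vec_norm v x \<le> r"
  shows "A *v y \<in> B"
proof -
  have small: "v (((A - mat 1) *v x) $ i) < r" for i
  proof -
    have "v ((A - mat 1) $ i $ j * x $ j) < r" for j
    proof (cases "x $ j = 0")
      case False
      have "v (x $ j) \<le> vec_norm v x" by (simp add: vec_norm_def)
      moreover have "\<delta> > 0" using A(2)[of i j] val_nonneg[of "(A - mat 1) $ i $ j"] by linarith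
      ultimately have "\<delta> * v (x $ j) \<le> r" using \<delta> mult_left_mono[of "v (x $ j)" "vec_norm v x" \<delta>] by linarith
      moreover have "v (x $ j) > 0" using False val_nonneg[of "x $ j"] val_eq_0_iff[of "x $ j"] by linarith
      then have "v ((A - mat 1) $ i $ j) * v (x $ j) < \<delta> * v (x $ j)" using A(2) by simp
      ultimately show ?thesis by (simp add: val_mult)
    qed (simp add: r)
    then show ?thesis unfolding matrix_vector_mult_def using r by (simp add: val_sum_less)
  qed
  have factor: "v (A $ i $ j * z) \<le> v z" for i j z
    using mult_right_mono[OF A(1)[of i j] val_nonneg[of z]] by (simp add: val_mult)
  have "A *v y - x = A *v (y - x) + (A - mat 1) *v x"
    by (simp add: matrix_vector_mult_diff_distrib matrix_vector_mult_diff_rdistrib)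
  then have split: "v ((A *v y - x) $ i) \<le> max (v ((A *v (y - x)) $ i)) (v (((A - mat 1) *v x) $ i))" for i
    using val_ultrametric by simp
  from B show ?thesis
  proof
    assume C: "B = closed_ball v x r"
    have "v ((A *v (y - x)) $ i) \<le> r" for i
      unfolding matrix_vector_mult_def vec_lambda_beta
      by (rule val_sum_le) (use factor order_trans r y C in \<open>auto simp: closed_ball_iff\<close>, blast+)
    then have "v ((A *v y - x) $ i) \<le> r" for i
      using split[of i] small[of i] by (meson less_imp_le max.bounded_iff order_trans)
    then show ?thesis unfolding C closed_ball_iff by blast
  next
    assume C: "B = open_ball v x r"
    have "v ((A *v (y - x)) $ i) < r" for i
      unfolding matrix_vector_mult_def vec_lambda_beta
      by (rule val_sum_less) (use factor le_less_trans r y C in \<open>auto simp: open_ball_iff\<close>, blast+)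
    then have "v ((A *v y - x) $ i) < r" for i
      using split[of i] small[of i] by (meson max_less_iff_conj le_less_trans)
    then show ?thesis unfolding C open_ball_iff by blast
  qed
qed

end

section \<open>The paradoxical decomposition of a ball\<close>

theorem theorem5p1:
  fixes v :: "'a::field \<Rightarrow> real" and \<epsilon> r :: real and x :: "'a ^ 'n" and B :: "('a ^ 'n) set"
  assumes "nonarch_valuation v"
    and "nontrivial_valuation v"
    and "0 < \<epsilon>" and "\<epsilon> \<le> 1"
    and "CARD('n) \<ge> 2"
    and "r > 0"
    and "B = closed_ball v x r \<or> B = open_ball v x r"
    and "0 \<notin> B"
  shows "paradoxical_using (SL v (coefficient_ring v) \<epsilon> :: ('a ^ 'n ^ 'n) monoid) (*v) 4 B"
proof -
  interpret nonarch_valuation v by (rule assms(1))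
  let ?R = "coefficient_ring v"
  obtain P T \<sigma> and i j k :: 'n where "blocks P T \<sigma> i j k" using blocks_exists[OF assms(5)] by blast
  then interpret blocks P T \<sigma> i j k .
  have norm: "vec_norm v x \<ge> 0"
    using val_nonneg[of "x $ i"] by (auto simp: vec_norm_def Max_ge_iff intro: exI[of _ i])
  \<comment> \<open>The second bound controls the displacement of the centre; adding 1 keeps the
    denominator positive.\<close>
  define \<delta> where "\<delta> = min \<epsilon> (r / (vec_norm v x + 1))"
  have \<delta>: "\<delta> > 0" "\<delta> \<le> \<epsilon>" using assms(3,6) norm by (auto simp: \<delta>_def)
  have "\<delta> * vec_norm v x \<le> \<delta> * (vec_norm v x + 1)" using \<delta> by simp
  also have "\<dots> \<le> r / (vec_norm v x + 1) * (vec_norm v x + 1)"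
    using norm by (intro mult_right_mono) (auto simp: \<delta>_def)
  finally have \<delta>r: "\<delta> * vec_norm v x \<le> r" using norm by simp
  obtain s t where s: "s \<in> ?R" "v s < \<delta>" and t: "t \<in> ?R" and free: "free_pair s t"
    using exists_small_free_pair[OF assms(2) \<delta>(1)] by blast
  \<comment> \<open>An auxiliary scalar for \<open>det_rep_gen\<close>: its square has valuation
    below one and so differs from one.\<close>
  obtain c where c: "c \<noteq> 0" "v c < 1" using nontrivial_obtains[OF assms(2)] by blast
  have "v (c * c) \<noteq> 1" using c(2) val_nonneg[of c] mult_strict_mono[of "v c" 1 "v c" 1] by (simp add: val_mult)
  then have cc: "c * c \<noteq> 1" using val_1 by auto
  define g where "g l = rep (gen s t l)" for l
  let ?I = "{x \<in> ?R. v x < \<delta>}"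
  interpret ring_ideal ?R ?I by (rule ring_ideal_small[OF \<delta>(1)])
  have gI: "(g l - mat 1) $ a $ b \<in> ?I" for l a b
    unfolding g_def
    by (rule rep_congruent_one[OF ring_ideal_axioms congruent_one_gen]) (use s t in auto)
  have gR: "g l $ a $ b \<in> ?R" for l a b
  proof -
    have "(g l - mat 1) $ a $ b + mat 1 $ a $ b \<in> ?R"
      using gI[of l a b] R_0 R_1 by (intro R_add) (auto simp: mat_def)
    then show ?thesis by simp
  qed
  have SL: "g l \<in> carrier (SL v ?R \<epsilon>)" for l
    using gR gI[of l] \<delta>(2) det_rep_gen[OF c(1) cc] unfolding SL_carrier_iff
    by (auto simp: g_def) (meson less_le_trans)
  have act: "letter_action B (\<lambda>l. (*v) (g l))"
  proof
    fix y l assume "y \<in> B"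
    then show "g l *v y \<in> B"
      using gI[of l] subsetD[OF coefficient_ring_subset gR[of l]]
      by (intro ball_invariant[OF assms(7,6) _ _ _ \<delta>r]) auto
    show "g (linv l) *v (g l *v y) = y"
      by (simp add: g_def gen_linv matrix_vector_mul_assoc mmul_madj rep_mone flip: rep_mmul)
  qed
  show ?thesis
  proof (rule paradoxical_using_4[OF act SL])
    show "\<one>\<^bsub>SL v ?R \<epsilon>\<^esub> \<in> carrier (SL v ?R \<epsilon> :: ('a ^ 'n ^ 'n) monoid)"
      using group_action_SL[OF assms(1,3), where 'n = 'n]
      by (simp add: group_action_def group_hom_def Group.group_def monoid.one_closed)
    show "\<one>\<^bsub>SL v ?R \<epsilon>\<^esub> *v y = y" for y :: "'a ^ 'n" by (simp add: SL_def)
    \<comment> \<open>Points of \<open>B\<close> are nonzero, so their stabilisers are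
      commutative.\<close>
    show "red (u @ w) = red (w @ u)"
      if "y \<in> B" "foldr (\<lambda>l. (*v) (g l)) u y = y" "foldr (\<lambda>l. (*v) (g l)) w y = y" for y u w
      using that assms(8) rep_locally_commutative[OF free, of y u w] unfolding g_def by blast
    have "x \<in> B" using assms(6,7) by (auto simp: closed_ball_iff open_ball_iff)
    then show "B \<noteq> {}" by blast
  qed
qed

end
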